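(* Let $\{w(f)\}$ be independent (not necessarily identically distributed) random variables indexed by the edges $f$ of the infinite bipartite graph $K_{tot}$, with $w(f)\ge 0$ almost surely for every $f$. Suppose there are non-decreasing functions $0\le F_{low}(x)\le F_{up}(x)\le 1$ (of $x\ge 0$) with $$F_{low}(x)\le\inf_f\mathbb{P}(w(f)\le x)\le\sup_f\mathbb{P}(w(f)\le x)\le F_{up}(x),$$ and such that $F_{up}(0)=0$ and $0<F_{low}(x)\le 1$ for each $0<x\le 1$. Suppose also that $\sup_f\mathbb{E}w^2(f)<\infty$. For $1\le\tau\le n$ let $M_n=M_n(\tau)$ be the minimum weight of a planar matching of $K_{n,n}$ containing at least $\tau$ edges, and let $$s_n:=\inf\left\{x>0: F_{up}(x)\ge\left(\frac{\tau}{64n}\right)^2\right\},\qquad t_n:=\sup\left\{x>0: F_{low}(x)\le\left(\frac{8\tau}{n}\right)^2\right\}.$$ Then there are constants $\alpha_1,\alpha_2,\beta_1,\beta_2,\gamma>0$, not depending on $n$ or $\tau$, such that the following hold for all $n$ and $\tau$ with $1\le\tau$ and $(\log n)^6\le\tau\le n$: (a) $\mathbb{P}(M_n\le\alpha_1\tau t_n)\ge 1-e^{-\alpha_2\tau}$ and $\mathbb{E}M_n\le\alpha_1\tau t_n+\alpha_1n^2e^{-\alpha_2\tau}$. (b) $\mathbb{P}(M_n\ge\beta_1\tau s_n)\ge 1-e^{-\beta_2(\log n)^2}$ and $\mathbb{E}M_n\ge\beta_1\tau s_n$. (c) $\mathrm{var}(M_n)\le\gamma c_n$, where $c_n:=\min\left(n,\frac{D\tau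 t_n}{s_n}\right)$ and $D=\max\left(1,\frac{2\alpha_1}{\beta_1}\right)$, with $\alpha_1,\beta_1$ the constants in (a) and (b).
   Context: $K_{tot}$ is the infinite bipartite graph with top vertices $u_1,u_2,\dots$, bottom vertices $v_1,v_2,\dots$ and all edges $(u_i,v_j)$, $i,j\ge 1$. For an integer $n\ge1$, $K_{n,n}\subset K_{tot}$ is the complete bipartite graph on top vertices $u_1,\dots,u_n$ and bottom vertices $v_1,\dots,v_n$. A planar matching of $K_{n,n}$ is a set of edges $\{(u_{i_1},v_{j_1}),\dots,(u_{i_t},v_{j_t})\}$ that can be indexed so that $i_1<i_2<\dots<i_t$ and $j_1<j_2<\dots<j_t$; its size is $t$. The number $w(f)$ is the weight of the edge $f$, and the weight of a planar matching $\mathcal{P}$ is $W(\mathcal{P})=\sum_{f\in\mathcal{P}}w(f)$. The infimum and supremum over $f$ are over all edges of $K_{tot}$. The quantity $t_n$ may equal $+\infty$, in which case the upper bounds in (a) are $+\infty$; if $t_n=+\infty$ or $s_n=0$, then $\frac{D\tau t_n}{s_n}$ is read as $+\infty$, so that $c_n=n$. *)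

theory Defs
  imports "HOL-Probability.Probability"
begin

text \<open>
  The edge joining the top vertex \<open>u\<^sub>i\<close> to the bottom vertex \<open>v\<^sub>j\<close> is the pair \<open>(i, j)\<close>;
  vertices are numbered from 1.
\<close>

definition K_tot :: "(nat \<times> nat) set" where
  "K_tot = {1..} \<times> {1..}"

definition K_nn :: "nat \<Rightarrow> (nat \<times> nat) set" where
  "K_nn n = {1..n} \<times> {1..n}"

definition planar_matching :: "nat \<Rightarrow> (nat \<times> nat) set \<Rightarrow> bool" where
  "planar_matching n P \<longleftrightarrow> P \<subseteq> K_nn n \<and>
     (\<exists>t i j. strict_mono_on {1..t} i \<and> strict_mono_on {1..t} j \<and>
        P = (\<lambda>k::nat. (i k, j k)) ` {1..t})"

definition matching_weight :: "(nat \<times> nat \<Rightarrow> real) \<Rightarrow> (nat \<times> nat) set \<Rightarrow> real" where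
  "matching_weight w P = (\<Sum>f\<in>P. w f)"

text \<open>
  For \<open>\<tau> \<le> n\<close> the minimum is taken over a finite nonempty set.
  The threshold \<open>\<tau>\<close> need not be an integer.
\<close>

definition min_weight :: "nat \<Rightarrow> real \<Rightarrow> (nat \<times> nat \<Rightarrow> real) \<Rightarrow> real" where
  "min_weight n \<tau> w =
     Min (matching_weight w ` {P. planar_matching n P \<and> real (card P) \<ge> \<tau>})"

definition s_val :: "(real \<Rightarrow> real) \<Rightarrow> nat \<Rightarrow> real \<Rightarrow> ereal" where
  "s_val F_up n \<tau> = Inf (ereal ` {x. x > 0 \<and> F_up x \<ge> (\<tau> / (64 * real n))\<^sup>2})"

definition t_val :: "(real \<Rightarrow> real) \<Rightarrow> nat \<Rightarrow> real \<Rightarrow> ereal" where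
  "t_val F_low n \<tau> = Sup (ereal ` {x. x > 0 \<and> F_low x \<le> (8 * \<tau> / real n)\<^sup>2})"

definition c_val ::
  "(real \<Rightarrow> real) \<Rightarrow> (real \<Rightarrow> real) \<Rightarrow> real \<Rightarrow> nat \<Rightarrow> real \<Rightarrow> ereal" where
  "c_val F_low F_up D n \<tau> =
     (let s = s_val F_up n \<tau>; t = t_val F_low n \<tau>
      in min (ereal (real n))
             (if t = \<infinity> \<or> s = 0 then \<infinity> else ereal (D * \<tau>) * t / s))"

end

theory Submission
  imports Defs
begin

text \<open>
  Weights may be replaced by their absolute values, and then only matchings with exactly
  \<open>m = \<lceil>\<tau>\<rceil>\<close> edges matter. For (a), at least \<open>m\<close> of \<open>2 m\<close> disjoint diagonal blocks contain an edge of
  weight at most \<open>2 t\<^sub>n\<close>. For (b), a matching of weight below \<open>\<tau> s\<^sub>n / 2\<close> contains at least \<open>\<tau> / 2\<close> edges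
  lighter than \<open>s\<^sub>n\<close>, which a union bound over planar matchings excludes. For (c), the Efron-Stein inequality
  is applied edge by edge: replacing the weight of \<open>f\<close> can raise the minimum only if every optimal
  matching contains \<open>f\<close>, and then by at most the new weight, which is independent of that event.
  Summing over \<open>f\<close> bounds the variance by the second moment times \<open>m \<le> 2 \<tau>\<close>, and \<open>\<tau> \<le> c\<^sub>n\<close>
  because \<open>s\<^sub>n \<le> t\<^sub>n\<close> and \<open>D \<ge> 1\<close>.
\<close>

subsection \<open>The Efron-Stein inequality\<close>

text \<open>Both thresholds carry a square because an edge has two endpoints. There are at most (n
  choose k)^2 planar matchings with k edges, and (n choose k) is at most (e n / k)^k; k independent
  edges, each light with probability at most (\<tau> / (64 n))^2, supply the same power 2 k. For k
  \<ge> \<tau> / 2 the base becomes at most e / 32, so the union bound decays. Dually, a diagonal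
  block of side L \<ge> n / (6 \<tau>) has L^2 edges, and the expected number of those with weight
  at most 2 t_n is at least (8 / 6)^2 = 16 / 9, which beats the entropy 2 ln 2 of choosing m empty
  blocks among 2 m. A supremum or infimum says nothing at the endpoint itself: hence 2 t_n instead
  of t_n, and "strictly lighter than s_n". If 8 \<tau> \<ge> n, then t_n is infinite and (a) is
  trivial, so the blocks are only needed when their side is at least 2. The variance bound must be
  linear in m although there are n^2 edges. This is why Efron-Stein is used in one-sided form: only
  increases of the minimum are charged, and at each point all edges able to cause one lie in a
  single optimal matching.\<close>

locale resampling =
  fixes K :: "'i set" and \<mu> :: "'i \<Rightarrow> 'b measure" and g :: "('i \<Rightarrow> 'b) \<Rightarrow> real"
  assumes prob_\<mu>: "\<And>i. i \<in> K \<Longrightarrow> prob_space (\<mu> i)"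
    and g_measurable [measurable]: "g \<in> borel_measurable (PiM K \<mu>)"
    and g_square: "integrable (PiM K \<mu>) (\<lambda>x. (g x)\<^sup>2)"
begin

text \<open>Two independent copies of every coordinate on one space: the tag \<open>False\<close>
  marks the original value, \<open>True\<close> the fresh one.\<close>

definition N :: "('i \<times> bool \<Rightarrow> 'b) measure" where
  "N = PiM (K \<times> UNIV) (\<lambda>p. \<mu> (fst p))"

text \<open>\<open>A\<close> is the set of resampled coordinates, so \<open>sel {}\<close> is the
  original sample and \<open>sel K\<close> an independent copy of it.\<close>

definition sel :: "'i set \<Rightarrow> ('i \<times> bool \<Rightarrow> 'b) \<Rightarrow> 'i \<Rightarrow> 'b" where
  "sel A \<omega> = (\<lambda>i\<in>K. \<omega> (i, i \<in> A))"

text \<open>Exchanges the two copies of each coordinate in \<open>A\<close>. It preserves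
  \<open>N\<close> and acts on \<open>sel\<close> by symmetric difference, so every exchangeability
  argument below becomes an identity between index sets.\<close>

definition flip :: "'i set \<Rightarrow> ('i \<times> bool \<Rightarrow> 'b) \<Rightarrow> 'i \<times> bool \<Rightarrow> 'b" where
  "flip A \<omega> = (\<lambda>p\<in>K \<times> UNIV. \<omega> (fst p, snd p \<noteq> (fst p \<in> A)))"

abbreviation G :: "'i set \<Rightarrow> ('i \<times> bool \<Rightarrow> 'b) \<Rightarrow> real" where
  "G A \<omega> \<equiv> g (sel A \<omega>)"

lemma prob_space_N: "prob_space N"
  unfolding N_def by (rule prob_space_PiM) (auto intro: prob_\<mu>)

sublocale N: prob_space N
  by (rule prob_space_N)

sublocale P: prob_space "PiM K \<mu>"
  by (rule prob_space_PiM) (auto intro: prob_\<mu>)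

lemma measurable_coordinate [measurable]:
  "i \<in> K \<Longrightarrow> (\<lambda>\<omega>. \<omega> (i, b)) \<in> measurable N (\<mu> i)"
  using measurable_component_singleton[of "(i, b)" "K \<times> UNIV" "\<lambda>p. \<mu> (fst p)"]
  unfolding N_def by simp

lemma measurable_sel [measurable]: "sel A \<in> measurable N (PiM K \<mu>)"
  unfolding sel_def by measurable

lemma measurable_flip [measurable]: "flip A \<in> measurable N N"
proof -
  have "flip A \<in> measurable N (PiM (K \<times> UNIV) (\<lambda>p. \<mu> (fst p)))"
    unfolding flip_def by (rule measurable_restrict) auto
  then show ?thesis by (simp add: N_def)
qed

lemma distr_sel: "distr N (PiM K \<mu>) (sel A) = PiM K \<mu>"
  using distr_PiM_reindex[of "K \<times> UNIV" "\<lambda>p. \<mu> (fst p)" "\<lambda>i. (i, i \<in> A)" K]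
  by (auto simp: N_def sel_def[abs_def] inj_on_def prob_\<mu>)

lemma distr_flip: "distr N N (flip A) = N"
proof -
  have "inj_on (\<lambda>p. (fst p, snd p \<noteq> (fst p \<in> A))) (K \<times> UNIV)"
    by (auto simp: inj_on_def)
  moreover have "(\<lambda>p. (fst p, snd p \<noteq> (fst p \<in> A))) \<in> K \<times> UNIV \<rightarrow> K \<times> UNIV"
    by auto
  ultimately show ?thesis
    using distr_PiM_reindex[of "K \<times> UNIV" "\<lambda>p. \<mu> (fst p)" "\<lambda>p. (fst p, snd p \<noteq> (fst p \<in> A))" "K \<times> UNIV"]
    by (simp add: N_def flip_def[abs_def] prob_\<mu> mem_Times_iff)
qed

lemma sel_flip: "sel B (flip A \<omega>) = sel ((A - B) \<union> (B - A)) \<omega>"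
  unfolding sel_def flip_def
proof (rule restrict_ext)
  fix i assume "i \<in> K"
  moreover have "((i \<in> B) \<noteq> (i \<in> A)) = (i \<in> (A - B) \<union> (B - A))" by auto
  ultimately show "(\<lambda>p\<in>K \<times> UNIV. \<omega> (fst p, snd p \<noteq> (fst p \<in> A))) (i, i \<in> B) =
      \<omega> (i, i \<in> (A - B) \<union> (B - A))"
    by (simp only: restrict_apply' mem_Times_iff fst_conv snd_conv UNIV_I simp_thms)
qed

lemma integral_flip:
  fixes h :: "_ \<Rightarrow> real"
  assumes [measurable]: "h \<in> borel_measurable N"
  shows "(\<integral>\<omega>. h (flip A \<omega>) \<partial>N) = (\<integral>\<omega>. h \<omega> \<partial>N)"
  using integral_distr[of "flip A" N N h] by (simp add: distr_flip)

lemma integral_sel: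
  fixes h :: "_ \<Rightarrow> real"
  assumes [measurable]: "h \<in> borel_measurable (PiM K \<mu>)"
  shows "(\<integral>\<omega>. h (sel A \<omega>) \<partial>N) = (\<integral>x. h x \<partial>PiM K \<mu>)"
  using integral_distr[of "sel A" N "PiM K \<mu>" h] by (simp add: distr_sel)

lemma integrable_sel:
  fixes h :: "_ \<Rightarrow> real"
  assumes [measurable]: "h \<in> borel_measurable (PiM K \<mu>)" and "integrable (PiM K \<mu>) h"
  shows "integrable N (\<lambda>\<omega>. h (sel A \<omega>))"
  using integrable_distr_eq[of "sel A" N "PiM K \<mu>" h] assms by (simp add: distr_sel)

lemma integrable_g: "integrable (PiM K \<mu>) g"
  by (rule P.square_integrable_imp_integrable[OF g_measurable g_square])

lemma integrable_G_mult: "integrable N (\<lambda>\<omega>. G A \<omega> * G B \<omega>)"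
proof (rule Bochner_Integration.integrable_bound)
  show "integrable N (\<lambda>\<omega>. (G A \<omega>)\<^sup>2 + (G B \<omega>)\<^sup>2)"
    using integrable_sel[OF _ g_square] by simp
  have "\<bar>a * b\<bar> \<le> a\<^sup>2 + b\<^sup>2" for a b :: real
  proof -
    have "2 * (\<bar>a\<bar> * \<bar>b\<bar>) \<le> a\<^sup>2 + b\<^sup>2"
      using sum_squares_bound[of "\<bar>a\<bar>" "\<bar>b\<bar>"] by (simp add: mult.assoc)
    moreover have "0 \<le> \<bar>a\<bar> * \<bar>b\<bar>" by simp
    ultimately show ?thesis unfolding abs_mult by linarith
  qed
  then show "AE \<omega> in N. norm (G A \<omega> * G B \<omega>) \<le> norm ((G A \<omega>)\<^sup>2 + (G B \<omega>)\<^sup>2)"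
    by simp
qed measurable

lemma integrable_G_square: "integrable N (\<lambda>\<omega>. (G A \<omega>)\<^sup>2)"
  using integrable_G_mult[of A A] by (simp add: power2_eq_square)

lemma integrable_diff_square: "integrable N (\<lambda>\<omega>. (G A \<omega> - G B \<omega>)\<^sup>2)"
  unfolding power2_diff
  using integrable_G_square integrable_G_mult[of A B]
  by (intro Bochner_Integration.integrable_add Bochner_Integration.integrable_diff)
     (auto simp: mult.assoc)

lemma integrable_diff_mult: "integrable N (\<lambda>\<omega>. G A \<omega> * (G B \<omega> - G C \<omega>))"
  unfolding right_diff_distrib
  by (intro Bochner_Integration.integrable_diff integrable_G_mult)

lemma indep_coordinates:
  "N.indep_vars (\<lambda>p. \<mu> (fst p)) (\<lambda>p \<omega>. \<omega> p) (K \<times> UNIV)"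
proof (cases "K = {}")
  case True
  then have "K \<times> (UNIV :: bool set) = {}" by simp
  then show ?thesis
    unfolding N.indep_vars_def N.indep_sets_def by (metis empty_iff subset_empty)
next
  case False
  have "distr N (PiM (K \<times> UNIV) (\<lambda>p. \<mu> (fst p))) (\<lambda>x. \<lambda>i\<in>K \<times> UNIV. x i) = distr N N (\<lambda>x. x)"
    by (rule distr_cong) (auto simp: N_def space_PiM restrict_PiE_iff)
  moreover have "(\<Pi>\<^sub>M p\<in>K \<times> UNIV. distr N (\<mu> (fst p)) (\<lambda>\<omega>. \<omega> p)) = N"
    unfolding N_def
    by (rule PiM_cong) (auto intro!: distr_PiM_component prob_\<mu>)
  ultimately show ?thesis
    using False by (subst N.indep_vars_iff_distr_eq_PiM')
      (auto simp: N_def distr_id[unfolded id_def])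
qed

text \<open>Needed twice: with \<open>l\<close> a function of the whole fresh sample, and with
  \<open>l\<close> depending on the fresh value of a single coordinate.\<close>

lemma indep_sel:
  fixes h :: "('i \<Rightarrow> 'b) \<Rightarrow> real" and l :: "('i \<times> bool \<Rightarrow> 'b) \<Rightarrow> real"
  assumes "h \<in> borel_measurable (PiM K \<mu>)"
    and "l \<in> borel_measurable (PiM (K \<times> {True}) (\<lambda>p. \<mu> (fst p)))"
  shows "N.indep_var borel (\<lambda>\<omega>. h (sel {} \<omega>)) borel (\<lambda>\<omega>. l (\<lambda>p\<in>K \<times> {True}. \<omega> p))"
proof -
  have "N.indep_var (PiM (K \<times> {False}) (\<lambda>p. \<mu> (fst p))) (\<lambda>\<omega>. \<lambda>p\<in>K \<times> {False}. \<omega> p)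
    (PiM (K \<times> {True}) (\<lambda>p. \<mu> (fst p))) (\<lambda>\<omega>. \<lambda>p\<in>K \<times> {True}. \<omega> p)"
    by (rule N.indep_var_restrict[OF indep_coordinates]) auto
  moreover have "(\<lambda>x. \<lambda>i\<in>K. x (i, False)) \<in> measurable (PiM (K \<times> {False}) (\<lambda>p. \<mu> (fst p))) (PiM K \<mu>)"
  proof (rule measurable_restrict)
    fix i assume "i \<in> K"
    then show "(\<lambda>x. x (i, False)) \<in> measurable (PiM (K \<times> {False}) (\<lambda>p. \<mu> (fst p))) (\<mu> i)"
      using measurable_component_singleton[of "(i, False)" "K \<times> {False}" "\<lambda>p. \<mu> (fst p)"] by simp
  qed
  then have "h \<circ> (\<lambda>x. \<lambda>i\<in>K. x (i, False)) \<in> borel_measurable (PiM (K \<times> {False}) (\<lambda>p. \<mu> (fst p)))"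
    by (rule measurable_comp[OF _ assms(1)])
  ultimately have "N.indep_var borel ((h \<circ> (\<lambda>x. \<lambda>i\<in>K. x (i, False))) \<circ> (\<lambda>\<omega>. \<lambda>p\<in>K \<times> {False}. \<omega> p))
    borel (l \<circ> (\<lambda>\<omega>. \<lambda>p\<in>K \<times> {True}. \<omega> p))"
    using assms(2) by (rule N.indep_var_compose)
  moreover have "(h \<circ> (\<lambda>x. \<lambda>i\<in>K. x (i, False))) \<circ> (\<lambda>\<omega>. \<lambda>p\<in>K \<times> {False}. \<omega> p) = (\<lambda>\<omega>. h (sel {} \<omega>))"
    by (auto simp: sel_def fun_eq_iff intro!: arg_cong[of _ _ h])
  ultimately show ?thesis by (simp add: comp_def)
qed

text \<open>This writes the squared mean as an expectation over \<open>N\<close>, so that the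
  variance becomes the mean of \<open>G {} * (G {} - G K)\<close>, which can be telescoped from
  \<open>{}\<close> to \<open>K\<close>.\<close>

lemma expectation_copies: "(\<integral>\<omega>. G {} \<omega> * G K \<omega> \<partial>N) = (\<integral>x. g x \<partial>PiM K \<mu>)\<^sup>2"
proof -
  let ?l = "\<lambda>x. g (\<lambda>i\<in>K. x (i, True))"
  have "(\<lambda>x. \<lambda>i\<in>K. x (i, True)) \<in> measurable (PiM (K \<times> {True}) (\<lambda>p. \<mu> (fst p))) (PiM K \<mu>)"
  proof (rule measurable_restrict)
    fix i assume "i \<in> K"
    then show "(\<lambda>x. x (i, True)) \<in> measurable (PiM (K \<times> {True}) (\<lambda>p. \<mu> (fst p))) (\<mu> i)"
      using measurable_component_singleton[of "(i, True)" "K \<times> {True}" "\<lambda>p. \<mu> (fst p)"] by simp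
  qed
  then have "?l \<in> borel_measurable (PiM (K \<times> {True}) (\<lambda>p. \<mu> (fst p)))"
    by (rule measurable_compose[OF _ g_measurable])
  from indep_sel[OF g_measurable this]
  have "N.indep_var borel (G {}) borel (G K)"
    by (simp add: sel_def cong: restrict_cong)
  then have "(\<integral>\<omega>. G {} \<omega> * G K \<omega> \<partial>N) = (\<integral>\<omega>. G {} \<omega> \<partial>N) * (\<integral>\<omega>. G K \<omega> \<partial>N)"
    by (rule N.indep_var_lebesgue_integral) (auto intro!: integrable_sel integrable_g)
  then show ?thesis
    by (simp add: integral_sel power2_eq_square)
qed

text \<open>Exchanging the copies of all coordinates in \<open>A\<close> moves the background from
  fresh to original values and leaves coordinate \<open>i\<close> alone.\<close>

lemma flip_diff_square:
  "i \<notin> A \<Longrightarrow> (\<integral>\<omega>. (G A \<omega> - G (insert i A) \<omega>)\<^sup>2 \<partial>N) = (\<integral>\<omega>. (G {} \<omega> - G {i} \<omega>)\<^sup>2 \<partial>N)"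
  using integral_flip[of "\<lambda>\<omega>. (G {} \<omega> - G {i} \<omega>)\<^sup>2" A] by (simp add: sel_flip insert_absorb Un_commute)

text \<open>Exchanging the two copies of coordinate \<open>i\<close> turns the increment into half of
  \<open>E (G \<emptyset> - G {i}) (G A - G (A \<union> {i}))\<close>.\<close>
lemma increment_le:
  assumes "i \<notin> A"
  shows "(\<integral>\<omega>. G {} \<omega> * (G A \<omega> - G (insert i A) \<omega>) \<partial>N) \<le> (\<integral>\<omega>. (G {} \<omega> - G {i} \<omega>)\<^sup>2 \<partial>N) / 2"
proof -
  let ?a = "\<lambda>\<omega>. G {} \<omega> - G {i} \<omega>" and ?b = "\<lambda>\<omega>. G A \<omega> - G (insert i A) \<omega>"
  have *: "({i} - A) \<union> (A - {i}) = insert i A" "({i} - insert i A) \<union> (insert i A - {i}) = A"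
    using assms by auto
  have "(\<integral>\<omega>. G {} \<omega> * ?b \<omega> \<partial>N) = (\<integral>\<omega>. G {i} \<omega> * (G (insert i A) \<omega> - G A \<omega>) \<partial>N)"
    using integral_flip[of "\<lambda>\<omega>. G {} \<omega> * ?b \<omega>" "{i}"] by (simp only: sel_flip *) simp
  then have "2 * (\<integral>\<omega>. G {} \<omega> * ?b \<omega> \<partial>N) =
      (\<integral>\<omega>. G {} \<omega> * ?b \<omega> \<partial>N) + (\<integral>\<omega>. G {i} \<omega> * (G (insert i A) \<omega> - G A \<omega>) \<partial>N)"
    by simp
  also have "\<dots> = (\<integral>\<omega>. G {} \<omega> * ?b \<omega> + G {i} \<omega> * (G (insert i A) \<omega> - G A \<omega>) \<partial>N)"
    by (rule Bochner_Integration.integral_add[symmetric]) (rule integrable_diff_mult)+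
  \<comment> \<open>The integrand is the product of \<open>?a\<close> and \<open>?b\<close>, which
    is at most half the sum of their squares; by \<open>flip_diff_square\<close> both squares have
    the same mean.\<close>
  also have "\<dots> \<le> (\<integral>\<omega>. (?a \<omega>)\<^sup>2 / 2 + (?b \<omega>)\<^sup>2 / 2 \<partial>N)"
  proof (rule integral_mono)
    show "integrable N (\<lambda>\<omega>. (?a \<omega>)\<^sup>2 / 2 + (?b \<omega>)\<^sup>2 / 2)"
      by (intro Bochner_Integration.integrable_add integrable_divide integrable_diff_square)
    fix \<omega>
    show "G {} \<omega> * ?b \<omega> + G {i} \<omega> * (G (insert i A) \<omega> - G A \<omega>) \<le> (?a \<omega>)\<^sup>2 / 2 + (?b \<omega>)\<^sup>2 / 2"
      using sum_squares_bound[of "?a \<omega>" "?b \<omega>"] by (simp add: algebra_simps)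
  qed (intro Bochner_Integration.integrable_add integrable_diff_mult)
  also have "\<dots> = (\<integral>\<omega>. (?a \<omega>)\<^sup>2 \<partial>N)"
    using flip_diff_square[OF assms] by (simp add: integrable_diff_square)
  finally show ?thesis by simp
qed

text \<open>Coordinates are replaced one at a time. The bound on an increment does not depend on
  those already replaced, so any order will do.\<close>

lemma telescoped_le:
  assumes "finite A"
  shows "(\<integral>\<omega>. G {} \<omega> * (G {} \<omega> - G A \<omega>) \<partial>N) \<le> (\<Sum>i\<in>A. (\<integral>\<omega>. (G {} \<omega> - G {i} \<omega>)\<^sup>2 \<partial>N) / 2)"
  using assms
proof induction
  case (insert i A)
  have "(\<integral>\<omega>. G {} \<omega> * (G {} \<omega> - G (insert i A) \<omega>) \<partial>N) =
    (\<integral>\<omega>. G {} \<omega> * (G {} \<omega> - G A \<omega>) + G {} \<omega> * (G A \<omega> - G (insert i A) \<omega>) \<partial>N)"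
    by (simp add: algebra_simps)
  also have "\<dots> = (\<integral>\<omega>. G {} \<omega> * (G {} \<omega> - G A \<omega>) \<partial>N) + (\<integral>\<omega>. G {} \<omega> * (G A \<omega> - G (insert i A) \<omega>) \<partial>N)"
    by (rule Bochner_Integration.integral_add) (rule integrable_diff_mult)+
  finally show ?case
    using insert increment_le[of i A] by simp
qed simp

text \<open>Exchanging the copies of \<open>i\<close> negates the difference, so its positive and
  negative parts have the same second moment. The part kept is the increase caused by resampling,
  which can be controlled from the original sample.\<close>

lemma diff_square_eq:
  "(\<integral>\<omega>. (G {} \<omega> - G {i} \<omega>)\<^sup>2 \<partial>N) = 2 * (\<integral>\<omega>. (max 0 (G {i} \<omega> - G {} \<omega>))\<^sup>2 \<partial>N)"
proof -
  let ?p = "\<lambda>A B \<omega>. (max 0 (G A \<omega> - G B \<omega>))\<^sup>2"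
  have int: "integrable N (?p A B)" for A B
    by (rule Bochner_Integration.integrable_bound[OF integrable_diff_square[of A B]])
       (auto simp: max_def)
  have "(\<integral>\<omega>. (G {} \<omega> - G {i} \<omega>)\<^sup>2 \<partial>N) = (\<integral>\<omega>. ?p {i} {} \<omega> + ?p {} {i} \<omega> \<partial>N)"
    by (rule Bochner_Integration.integral_cong) (auto simp: max_def power2_commute)
  also have "\<dots> = (\<integral>\<omega>. ?p {i} {} \<omega> \<partial>N) + (\<integral>\<omega>. ?p {} {i} \<omega> \<partial>N)"
    by (rule Bochner_Integration.integral_add[OF int int])
  also have "(\<integral>\<omega>. ?p {} {i} \<omega> \<partial>N) = (\<integral>\<omega>. ?p {i} {} \<omega> \<partial>N)"
    using integral_flip[of "?p {} {i}" "{i}"] by (simp add: sel_flip)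
  finally show ?thesis by simp
qed

theorem efron_stein:
  assumes "finite K"
  shows "P.variance g \<le> (\<Sum>i\<in>K. (\<integral>\<omega>. (max 0 (G {i} \<omega> - G {} \<omega>))\<^sup>2 \<partial>N))"
proof -
  have "P.variance g = (\<integral>x. (g x)\<^sup>2 \<partial>PiM K \<mu>) - (\<integral>x. g x \<partial>PiM K \<mu>)\<^sup>2"
    by (rule P.variance_eq[OF integrable_g g_square])
  also have "\<dots> = (\<integral>\<omega>. (G {} \<omega>)\<^sup>2 \<partial>N) - (\<integral>\<omega>. G {} \<omega> * G K \<omega> \<partial>N)"
    by (simp add: expectation_copies integral_sel[of "\<lambda>x. (g x)\<^sup>2"])
  also have "\<dots> = (\<integral>\<omega>. (G {} \<omega>)\<^sup>2 - G {} \<omega> * G K \<omega> \<partial>N)"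
    by (rule Bochner_Integration.integral_diff[symmetric, OF integrable_G_square integrable_G_mult])
  also have "\<dots> = (\<integral>\<omega>. G {} \<omega> * (G {} \<omega> - G K \<omega>) \<partial>N)"
    by (simp add: algebra_simps power2_eq_square)
  also have "\<dots> \<le> (\<Sum>i\<in>K. (\<integral>\<omega>. (G {} \<omega> - G {i} \<omega>)\<^sup>2 \<partial>N) / 2)"
    by (rule telescoped_le[OF assms])
  finally show ?thesis by (simp add: diff_square_eq)
qed

end

section \<open>Variance of a minimum of sums\<close>

text \<open>The absolute values ensure that discarding the old value of a coordinate never raises a
  sum, so that an increase is bounded by the new value alone. Only the size \<open>m\<close> of the
  sets enters the bound, neither their number nor \<open>card K\<close>.\<close>

lemma (in prob_space) variance_Min_sum_le:
  fixes X :: "'i \<Rightarrow> 'a \<Rightarrow> real"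
  assumes indep: "indep_vars (\<lambda>_. borel) X K" and K: "finite K" "K \<noteq> {}"
    and square: "\<And>i. i \<in> K \<Longrightarrow> integrable M (\<lambda>\<omega>. (X i \<omega>)\<^sup>2)"
    and C: "\<And>i. i \<in> K \<Longrightarrow> expectation (\<lambda>\<omega>. (X i \<omega>)\<^sup>2) \<le> C"
    and S: "finite S" "S \<noteq> {}" "\<And>P. P \<in> S \<Longrightarrow> P \<subseteq> K" "\<And>P. P \<in> S \<Longrightarrow> card P \<le> m"
  shows "variance (\<lambda>\<omega>. Min ((\<lambda>P. \<Sum>i\<in>P. \<bar>X i \<omega>\<bar>) ` S)) \<le> C * real m"
proof -
  define \<mu> where "\<mu> i = distr M borel (X i)" for i
  define g :: "('i \<Rightarrow> real) \<Rightarrow> real" where "g x = Min ((\<lambda>P. \<Sum>i\<in>P. \<bar>x i\<bar>) ` S)" for x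
  \<comment> \<open>\<open>E i\<close>: every optimal \<open>P\<close> contains \<open>i\<close>; otherwise resampling \<open>i\<close> cannot raise the minimum.\<close>
  define E where "E i = {x. \<forall>P\<in>S. i \<notin> P \<longrightarrow> g x < (\<Sum>j\<in>P. \<bar>x j\<bar>)}" for i
  have X [measurable]: "i \<in> K \<Longrightarrow> X i \<in> borel_measurable M" for i
    using indep by (auto simp: indep_vars_def)
  have distr_X: "distr M (PiM K \<mu>) (\<lambda>\<omega>. \<lambda>i\<in>K. X i \<omega>) = PiM K \<mu>"
  proof -
    have "distr M (PiM K \<mu>) (\<lambda>\<omega>. \<lambda>i\<in>K. X i \<omega>) = distr M (PiM K (\<lambda>_. borel)) (\<lambda>\<omega>. \<lambda>i\<in>K. X i \<omega>)"
      by (intro distr_cong sets_PiM_cong refl) (simp add: \<mu>_def)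
    also have "\<dots> = PiM K (\<lambda>i. distr M borel (X i))"
      using indep_vars_iff_distr_eq_PiM'[of K X "\<lambda>_. borel"] indep K X by blast
    finally show ?thesis by (simp add: \<mu>_def[abs_def])
  qed
  have X_PiM [measurable]: "(\<lambda>\<omega>. \<lambda>i\<in>K. X i \<omega>) \<in> measurable M (PiM K \<mu>)"
    by (rule measurable_restrict) (simp add: \<mu>_def)
  have coord [measurable]: "i \<in> K \<Longrightarrow> (\<lambda>x. x i) \<in> borel_measurable (PiM K \<mu>)" for i
    using measurable_component_singleton[of i K \<mu>] by (simp add: \<mu>_def)
  have weight_measurable [measurable]:
    "P \<in> S \<Longrightarrow> (\<lambda>x. \<Sum>i\<in>P. \<bar>x i\<bar>) \<in> borel_measurable (PiM K \<mu>)" for P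
    using S(3)[of P] by (intro borel_measurable_sum borel_measurable_abs coord) auto
  have g_measurable [measurable]: "g \<in> borel_measurable (PiM K \<mu>)"
    unfolding g_def[abs_def] using S by (intro borel_measurable_Min) auto
  have g_le: "P \<in> S \<Longrightarrow> g x \<le> (\<Sum>i\<in>P. \<bar>x i\<bar>)" for P x
    unfolding g_def using S by (intro Min_le) auto
  have g_attained: "\<exists>P\<in>S. g x = (\<Sum>i\<in>P. \<bar>x i\<bar>)" for x
  proof -
    have "g x \<in> (\<lambda>P. \<Sum>i\<in>P. \<bar>x i\<bar>) ` S"
      unfolding g_def using S by (intro Min_in) auto
    then show ?thesis by auto
  qed
  have g_nonneg: "0 \<le> g x" for x
    using g_attained[of x] by (auto intro: sum_nonneg)
  have g_X: "g (\<lambda>i\<in>K. X i \<omega>) = Min ((\<lambda>P. \<Sum>i\<in>P. \<bar>X i \<omega>\<bar>) ` S)" for \<omega>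
    unfolding g_def using S(3) by (intro arg_cong[of _ _ Min] image_cong refl sum.cong) auto
  \<comment> \<open>A crude bound suffices for square integrability: the minimum is at most the sum
    over all of \<open>K\<close>, to which Cauchy-Schwarz applies.\<close>
  have "integrable M (\<lambda>\<omega>. (g (\<lambda>i\<in>K. X i \<omega>))\<^sup>2)"
  proof (rule Bochner_Integration.integrable_bound)
    show "integrable M (\<lambda>\<omega>. real (card K) * (\<Sum>i\<in>K. (X i \<omega>)\<^sup>2))"
      using square by auto
    show "AE \<omega> in M. norm ((g (\<lambda>i\<in>K. X i \<omega>))\<^sup>2) \<le> norm (real (card K) * (\<Sum>i\<in>K. (X i \<omega>)\<^sup>2))"
    proof (rule AE_I2)
      fix \<omega>
      obtain P where P: "P \<in> S" using S by auto
      have "g (\<lambda>i\<in>K. X i \<omega>) \<le> (\<Sum>i\<in>P. \<bar>(\<lambda>i\<in>K. X i \<omega>) i\<bar>)"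
        by (rule g_le[OF P])
      also have "\<dots> = (\<Sum>i\<in>P. \<bar>X i \<omega>\<bar>)"
        using S(3)[OF P] by (intro sum.cong) auto
      also have "\<dots> \<le> (\<Sum>i\<in>K. \<bar>X i \<omega>\<bar>)"
        using S(3)[OF P] K by (intro sum_mono2) auto
      finally have "(g (\<lambda>i\<in>K. X i \<omega>))\<^sup>2 \<le> (\<Sum>i\<in>K. \<bar>X i \<omega>\<bar>)\<^sup>2"
        using g_nonneg by (intro power_mono) auto
      also have "\<dots> \<le> real (card K) * (\<Sum>i\<in>K. (X i \<omega>)\<^sup>2)"
        using sum_squared_le_sum_of_squares[of "\<lambda>i. \<bar>X i \<omega>\<bar>" K] by (simp add: mult.commute)
      finally show "norm ((g (\<lambda>i\<in>K. X i \<omega>))\<^sup>2) \<le> norm (real (card K) * (\<Sum>i\<in>K. (X i \<omega>)\<^sup>2))"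
        by simp
    qed
  qed measurable
  then have g_square: "integrable (PiM K \<mu>) (\<lambda>x. (g x)\<^sup>2)"
    using integrable_distr_eq[OF X_PiM, of "\<lambda>x. (g x)\<^sup>2"]
    unfolding distr_X by (metis borel_measurable_power g_measurable)
  interpret R: resampling K \<mu> g
    using g_square by (intro resampling.intro) (simp_all add: g_measurable, simp add: \<mu>_def prob_space_distr)
  have E_sets [measurable]: "Measurable.pred (PiM K \<mu>) (\<lambda>x. x \<in> E i)" for i
    unfolding E_def mem_Collect_eq by (rule pred_intros_finite(3)[OF S(1)]) measurable
  have ind_measurable [measurable]: "indicator (E i) \<in> borel_measurable (PiM K \<mu>)" for i
    by measurable
  have int_E: "integrable (PiM K \<mu>) (indicator (E i) :: _ \<Rightarrow> real)" for i
    by (rule R.P.integrable_const_bound[where B=1]) (auto simp: indicator_def)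
  have increment: "max 0 (g (x(i := y)) - g x) \<le> \<bar>y\<bar> * indicator (E i) x" for x i y
  proof (cases "x \<in> E i")
    case True
    obtain P where P: "P \<in> S" "g x = (\<Sum>j\<in>P. \<bar>x j\<bar>)" using g_attained by auto
    have "finite P" using S(3)[OF P(1)] K(1) by (rule finite_subset)
    have "g (x(i := y)) \<le> (\<Sum>j\<in>P. \<bar>(x(i := y)) j\<bar>)"
      by (rule g_le[OF P(1)])
    \<comment> \<open>At \<open>j = i\<close> the nonnegative old value is kept merely as
      slack.\<close>
    also have "\<dots> \<le> (\<Sum>j\<in>P. \<bar>x j\<bar> + (if j = i then \<bar>y\<bar> else 0))"
      by (intro sum_mono) auto
    also have "\<dots> \<le> g x + \<bar>y\<bar>"
      using \<open>finite P\<close> by (simp add: sum.distrib P(2))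
    finally show ?thesis using True by simp
  next
    case False
    then obtain P where P: "P \<in> S" "i \<notin> P" "(\<Sum>j\<in>P. \<bar>x j\<bar>) \<le> g x"
      unfolding E_def by (auto simp: not_less)
    have "g (x(i := y)) \<le> (\<Sum>j\<in>P. \<bar>(x(i := y)) j\<bar>)"
      by (rule g_le[OF P(1)])
    also have "\<dots> = (\<Sum>j\<in>P. \<bar>x j\<bar>)"
      using P(2) by (intro sum.cong) auto
    finally show ?thesis using P(3) by simp
  qed
  \<comment> \<open>Fix one minimiser \<open>P\<close> at \<open>x\<close>. Every \<open>i\<close>
    with \<open>x \<in> E i\<close> lies in \<open>P\<close>, so there are at most
    \<open>card P\<close> of them.\<close>
  have E_sum: "(\<Sum>i\<in>K. indicator (E i) x) \<le> real m" for x
  proof -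
    obtain P where P: "P \<in> S" "g x = (\<Sum>j\<in>P. \<bar>x j\<bar>)" using g_attained by auto
    have "(\<Sum>i\<in>K. indicator (E i) x) \<le> (\<Sum>i\<in>K. if i \<in> P then 1 else 0 :: real)"
      using P by (intro sum_mono) (auto simp: E_def indicator_def)
    also have "\<dots> = card P"
      using S(3)[OF P(1)] K by (simp add: sum.If_cases Int_absorb1)
    finally show ?thesis using S(4)[OF P(1)] by simp
  qed
  have second_moment: "(\<integral>\<omega>. (\<omega> (i, True))\<^sup>2 \<partial>R.N) = expectation (\<lambda>\<omega>. (X i \<omega>)\<^sup>2)"
    "integrable R.N (\<lambda>\<omega>. (\<omega> (i, True))\<^sup>2)" if i: "i \<in> K" for i
  proof -
    have d: "distr R.N (\<mu> i) (\<lambda>\<omega>. \<omega> (i, True)) = \<mu> i"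
      using i distr_PiM_component[of "K \<times> UNIV" "\<lambda>p. \<mu> (fst p)" "(i, True)"] R.prob_\<mu>
      by (auto simp: R.N_def)
    have "(\<integral>\<omega>. (\<omega> (i, True))\<^sup>2 \<partial>R.N) = (\<integral>y. y\<^sup>2 \<partial>\<mu> i)"
      using integral_distr[OF R.measurable_coordinate[OF i, of True], of "\<lambda>y. y\<^sup>2"] by (simp add: d) (simp add: \<mu>_def)
    then show "(\<integral>\<omega>. (\<omega> (i, True))\<^sup>2 \<partial>R.N) = expectation (\<lambda>\<omega>. (X i \<omega>)\<^sup>2)"
      using i by (simp add: \<mu>_def integral_distr)
    have "integrable (\<mu> i) (\<lambda>y. y\<^sup>2)"
      using square i by (simp add: \<mu>_def integrable_distr_eq)
    then show "integrable R.N (\<lambda>\<omega>. (\<omega> (i, True))\<^sup>2)"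
      using integrable_distr_eq[OF R.measurable_coordinate[OF i, of True], of "\<lambda>y. y\<^sup>2"] by (simp add: d)
  qed
  have term_le: "(\<integral>\<omega>. (max 0 (g (R.sel {i} \<omega>) - g (R.sel {} \<omega>)))\<^sup>2 \<partial>R.N) \<le>
      C * (\<integral>x. indicator (E i) x \<partial>PiM K \<mu>)" if i: "i \<in> K" for i
  proof -
    have "R.N.indep_var borel (\<lambda>\<omega>. indicator (E i) (R.sel {} \<omega>)) borel
        (\<lambda>\<omega>. (\<lambda>x. (x (i, True))\<^sup>2) (\<lambda>p\<in>K \<times> {True}. \<omega> p))"
    proof (rule R.indep_sel[OF ind_measurable])
      have "(\<lambda>x. x (i, True)) \<in> borel_measurable (PiM (K \<times> {True}) (\<lambda>p. \<mu> (fst p)))"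
        using i measurable_component_singleton[of "(i, True)" "K \<times> {True}" "\<lambda>p. \<mu> (fst p)"]
        by (simp add: \<mu>_def)
      then show "(\<lambda>x. (x (i, True))\<^sup>2) \<in> borel_measurable (PiM (K \<times> {True}) (\<lambda>p. \<mu> (fst p)))"
        by measurable
    qed
    then have ind: "R.N.indep_var borel (\<lambda>\<omega>. indicator (E i) (R.sel {} \<omega>)) borel (\<lambda>\<omega>. (\<omega> (i, True))\<^sup>2)"
      using i by simp
    note int_sel = R.integrable_sel[OF ind_measurable int_E, where A="{}"]
    have "(\<integral>\<omega>. (max 0 (g (R.sel {i} \<omega>) - g (R.sel {} \<omega>)))\<^sup>2 \<partial>R.N) \<le>
        (\<integral>\<omega>. indicator (E i) (R.sel {} \<omega>) * (\<omega> (i, True))\<^sup>2 \<partial>R.N)"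
    proof (rule integral_mono')
      show "integrable R.N (\<lambda>\<omega>. indicator (E i) (R.sel {} \<omega>) * (\<omega> (i, True))\<^sup>2)"
        by (rule R.N.indep_var_integrable[OF ind int_sel second_moment(2)[OF i]])
      fix \<omega>
      have "R.sel {i} \<omega> = (R.sel {} \<omega>)(i := \<omega> (i, True))"
        using i by (auto simp: R.sel_def)
      then have "(max 0 (g (R.sel {i} \<omega>) - g (R.sel {} \<omega>)))\<^sup>2
          \<le> (\<bar>\<omega> (i, True)\<bar> * indicator (E i) (R.sel {} \<omega>))\<^sup>2"
        using increment by (intro power_mono) auto
      also have "\<dots> = indicator (E i) (R.sel {} \<omega>) * (\<omega> (i, True))\<^sup>2"
        by (auto simp: indicator_def)
      finally show "(max 0 (g (R.sel {i} \<omega>) - g (R.sel {} \<omega>)))\<^sup>2 \<le>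
          indicator (E i) (R.sel {} \<omega>) * (\<omega> (i, True))\<^sup>2" .
    qed simp
    also have "\<dots> = (\<integral>x. indicator (E i) x \<partial>PiM K \<mu>) * expectation (\<lambda>\<omega>. (X i \<omega>)\<^sup>2)"
      using R.N.indep_var_lebesgue_integral[OF ind int_sel second_moment(2)[OF i]]
        R.integral_sel[OF ind_measurable, where A="{}"] second_moment(1)[OF i] by simp
    also have "\<dots> \<le> (\<integral>x. indicator (E i) x \<partial>PiM K \<mu>) * C"
      by (intro mult_left_mono C i) simp
    finally show ?thesis by (simp add: mult.commute)
  qed
  obtain i0 where i0: "i0 \<in> K" using K by auto
  have "0 \<le> expectation (\<lambda>\<omega>. (X i0 \<omega>)\<^sup>2)" by simp
  then have C_nonneg: "0 \<le> C" using C[OF i0] by linarith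
  have "variance (\<lambda>\<omega>. Min ((\<lambda>P. \<Sum>i\<in>P. \<bar>X i \<omega>\<bar>) ` S)) = R.P.variance g"
  proof -
    have "R.P.expectation g = expectation (\<lambda>\<omega>. g (\<lambda>i\<in>K. X i \<omega>))"
      using integral_distr[OF X_PiM g_measurable] by (simp add: distr_X)
    moreover have "R.P.expectation (\<lambda>x. (g x - c)\<^sup>2) = expectation (\<lambda>\<omega>. (g (\<lambda>i\<in>K. X i \<omega>) - c)\<^sup>2)" for c
      using integral_distr[OF X_PiM, of "\<lambda>x. (g x - c)\<^sup>2"] by (simp add: distr_X)
    ultimately show ?thesis by (simp add: g_X)
  qed
  also have "\<dots> \<le> (\<Sum>i\<in>K. (\<integral>\<omega>. (max 0 (g (R.sel {i} \<omega>) - g (R.sel {} \<omega>)))\<^sup>2 \<partial>R.N))"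
    by (rule R.efron_stein[OF K(1)])
  also have "\<dots> \<le> (\<Sum>i\<in>K. C * (\<integral>x. indicator (E i) x \<partial>PiM K \<mu>))"
    by (intro sum_mono term_le)
  also have "\<dots> = C * (\<integral>x. (\<Sum>i\<in>K. indicator (E i) x) \<partial>PiM K \<mu>)"
    by (simp only: sum_distrib_left[symmetric] Bochner_Integration.integral_sum[OF int_E])
  also have "(\<integral>x. (\<Sum>i\<in>K. indicator (E i) x) \<partial>PiM K \<mu>) \<le> (\<integral>x. real m \<partial>PiM K \<mu>)"
    by (intro integral_mono E_sum Bochner_Integration.integrable_sum int_E) auto
  finally show ?thesis using C_nonneg by (simp add: R.P.prob_space mult_left_mono)
qed

subsection \<open>Planar matchings\<close>

lemma finite_K_nn [simp]: "finite (K_nn n)"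
  by (simp add: K_nn_def)

lemma inj_on_chain:
  fixes P :: "(nat \<times> nat) set"
  assumes "\<forall>p\<in>P. \<forall>q\<in>P. p \<noteq> q \<longrightarrow> fst p < fst q \<and> snd p < snd q \<or> fst q < fst p \<and> snd q < snd p"
  shows "inj_on fst P" "inj_on snd P"
  using assms by (metis inj_onI less_irrefl)+

text \<open>Planarity as a pairwise condition, namely being a strict chain in both coordinates. In
  this form it passes to subsets at once and can be checked without an explicit indexing.\<close>

lemma planar_matching_iff:
  "planar_matching n P \<longleftrightarrow> P \<subseteq> K_nn n \<and>
    (\<forall>p\<in>P. \<forall>q\<in>P. p \<noteq> q \<longrightarrow> fst p < fst q \<and> snd p < snd q \<or> fst q < fst p \<and> snd q < snd p)"
  (is "_ \<longleftrightarrow> _ \<and> ?chain P")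
proof
  assume "planar_matching n P"
  then obtain t i j where P: "P \<subseteq> K_nn n" "strict_mono_on {1..t} i" "strict_mono_on {1..t} j"
    "P = (\<lambda>k::nat. (i k, j k)) ` {1..t}"
    unfolding planar_matching_def by blast
  have "?chain P"
  proof (intro ballI impI)
    fix p q assume "p \<in> P" "q \<in> P" "p \<noteq> q"
    obtain k where k: "k \<in> {1..t}" "p = (i k, j k)"
      using \<open>p \<in> P\<close> unfolding P(4) by blast
    obtain l where l: "l \<in> {1..t}" "q = (i l, j l)"
      using \<open>q \<in> P\<close> unfolding P(4) by blast
    have "k \<noteq> l" using \<open>p \<noteq> q\<close> k(2) l(2) by blast
    then have "k < l \<or> l < k" by linarith
    then show "fst p < fst q \<and> snd p < snd q \<or> fst q < fst p \<and> snd q < snd p"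
      using strict_mono_onD[OF P(2) k(1) l(1)] strict_mono_onD[OF P(3) k(1) l(1)]
        strict_mono_onD[OF P(2) l(1) k(1)] strict_mono_onD[OF P(3) l(1) k(1)] k(2) l(2) by auto
  qed
  with P(1) show "P \<subseteq> K_nn n \<and> ?chain P" by blast
next
  assume *: "P \<subseteq> K_nn n \<and> ?chain P"
  then have PK: "P \<subseteq> K_nn n" and chain: "?chain P" by simp_all
  have "finite P" using PK by (rule finite_subset) simp
  have inj: "inj_on fst P" using chain by (rule inj_on_chain)
  \<comment> \<open>Sorting the top vertices yields the indexing; the chain condition forces the
    bottom vertices into the same order.\<close>
  obtain h where h: "bij_betw h {..<card (fst ` P)} (fst ` P)" "strict_mono_on {..<card (fst ` P)} h"
    using ex_bij_betw_strict_mono_card[of "fst ` P"] \<open>finite P\<close> by blast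
  define t where "t = card (fst ` P)"
  \<comment> \<open>The shift reconciles \<open>h\<close>, which enumerates from 0, with the
    indexing of matchings from 1.\<close>
  define e where "e k = the_inv_into P fst (h (k - 1))" for k :: nat
  have e: "e k \<in> P" "fst (e k) = h (k - 1)" if "k \<in> {1..t}" for k
  proof -
    have "h (k - 1) \<in> fst ` P"
      using h(1) that by (auto simp: t_def bij_betw_def)
    then show "e k \<in> P" "fst (e k) = h (k - 1)"
      unfolding e_def using inj by (auto intro: the_inv_into_into simp: f_the_inv_into_f)
  qed
  have mono: "fst (e k) < fst (e l)" if "k \<in> {1..t}" "l \<in> {1..t}" "k < l" for k l
    using that h(2) e by (auto simp: t_def intro!: strict_mono_onD[OF h(2)])
  have mono2: "snd (e k) < snd (e l)" if "k \<in> {1..t}" "l \<in> {1..t}" "k < l" for k l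
    using chain[rule_format, OF e(1)[OF that(1)] e(1)[OF that(2)]] mono[OF that]
    by (cases "e k = e l") auto
  have "P = e ` {1..t}"
  proof
    show "e ` {1..t} \<subseteq> P" using e(1) by blast
    show "P \<subseteq> e ` {1..t}"
    proof
      fix p assume "p \<in> P"
      then have "fst p \<in> h ` {..<t}" using h(1) by (auto simp: t_def bij_betw_def)
      then obtain k where k: "k < t" "h k = fst p" by auto
      then have "e (Suc k) = p"
        using e[of "Suc k"] inj \<open>p \<in> P\<close> by (auto simp: inj_on_def)
      then show "p \<in> e ` {1..t}"
        using k by (intro image_eqI[of _ _ "Suc k"]) auto
    qed
  qed
  then have "P = (\<lambda>k. (fst (e k), snd (e k))) ` {1..t}" by simp
  moreover have "strict_mono_on {1..t} (\<lambda>k. fst (e k))" "strict_mono_on {1..t} (\<lambda>k. snd (e k))"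
    using mono mono2 by (auto intro!: strict_mono_onI)
  ultimately show "planar_matching n P"
    unfolding planar_matching_def using PK by blast
qed

lemma planar_matching_chain:
  assumes "planar_matching n P" "p \<in> P" "q \<in> P" "p \<noteq> q"
  shows "fst p < fst q \<and> snd p < snd q \<or> fst q < fst p \<and> snd q < snd p"
  using assms unfolding planar_matching_iff by simp

lemma planar_matching_inj_on:
  assumes "planar_matching n P"
  shows "inj_on fst P" "inj_on snd P"
  using assms unfolding planar_matching_iff by (auto intro: inj_on_chain)

lemma planar_matching_K_nn: "planar_matching n P \<Longrightarrow> P \<subseteq> K_nn n"
  unfolding planar_matching_iff by simp

lemma planar_matching_subset:
  assumes "planar_matching n P" "Q \<subseteq> P"
  shows "planar_matching n Q"
  unfolding planar_matching_iff
proof (intro conjI ballI impI)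
  show "Q \<subseteq> K_nn n" using assms planar_matching_K_nn by (meson subset_trans)
  fix p q assume "p \<in> Q" "q \<in> Q" "p \<noteq> q"
  then show "fst p < fst q \<and> snd p < snd q \<or> fst q < fst p \<and> snd q < snd p"
    using assms(2) by (intro planar_matching_chain[OF assms(1)]) auto
qed

lemma planar_matching_finite: "planar_matching n P \<Longrightarrow> finite P"
  by (rule finite_subset[OF planar_matching_K_nn finite_K_nn])

lemma finite_planar_matchings: "finite {P. planar_matching n P}"
  by (rule finite_subset[of _ "Pow (K_nn n)"]) (auto dest: planar_matching_K_nn)

lemma ex_planar_matching:
  assumes "m \<le> n"
  shows "\<exists>P. planar_matching n P \<and> card P = m"
proof (intro exI conjI)
  show "planar_matching n ((\<lambda>k. (k, k)) ` {1..m})"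
    using assms unfolding planar_matching_iff by (auto simp: K_nn_def)
  show "card ((\<lambda>k. (k, k)) ` {1..m}) = m"
    by (subst card_image) (auto simp: inj_on_def)
qed

section \<open>Reduction to matchings of one fixed size\<close>

lemma min_weight_eq_Min:
  assumes nonneg: "\<And>f. f \<in> K_nn n \<Longrightarrow> 0 \<le> w f" and "0 \<le> \<tau>" "\<tau> \<le> real n"
  shows "min_weight n \<tau> w =
    Min (matching_weight w ` {P. planar_matching n P \<and> card P = nat \<lceil>\<tau>\<rceil>})" (is "_ = Min (_ ` ?S)")
proof -
  let ?T = "{P. planar_matching n P \<and> real (card P) \<ge> \<tau>}"
  have T: "P \<in> ?T \<longleftrightarrow> planar_matching n P \<and> nat \<lceil>\<tau>\<rceil> \<le> card P" for P
    by (auto simp: nat_le_iff ceiling_le_iff)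
  have "finite ?T" by (rule finite_subset[OF _ finite_planar_matchings]) auto
  have "nat \<lceil>\<tau>\<rceil> \<le> n" using assms(3) by (simp add: nat_le_iff ceiling_le_iff)
  then have "?S \<noteq> {}" using ex_planar_matching by auto
  have "?S \<subseteq> ?T"
  proof
    fix P assume "P \<in> ?S"
    then have "planar_matching n P \<and> nat \<lceil>\<tau>\<rceil> \<le> card P" by simp
    then show "P \<in> ?T" using T by blast
  qed
  have "Min (matching_weight w ` ?T) = Min (matching_weight w ` ?S)"
  proof (rule antisym)
    show "Min (matching_weight w ` ?T) \<le> Min (matching_weight w ` ?S)"
      using \<open>?S \<subseteq> ?T\<close> \<open>?S \<noteq> {}\<close> \<open>finite ?T\<close> by (intro Min_antimono image_mono) auto
    have "Min (matching_weight w ` ?T) \<in> matching_weight w ` ?T"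
      using \<open>?S \<subseteq> ?T\<close> \<open>?S \<noteq> {}\<close> \<open>finite ?T\<close> by (intro Min_in) auto
    then obtain P where P: "P \<in> ?T" "Min (matching_weight w ` ?T) = matching_weight w P" by auto
    from P(1) obtain Q where Q: "Q \<subseteq> P" "card Q = nat \<lceil>\<tau>\<rceil>"
      using T obtain_subset_with_card_n by metis
    then have "Q \<in> ?S" using P(1) planar_matching_subset by blast
    then have "Min (matching_weight w ` ?S) \<le> matching_weight w Q"
      using finite_subset[OF \<open>?S \<subseteq> ?T\<close> \<open>finite ?T\<close>] by (intro Min_le) auto
    also have "\<dots> \<le> matching_weight w P"
      unfolding matching_weight_def
    proof (rule sum_mono2)
      show "finite P" using P(1) planar_matching_finite by auto
      show "0 \<le> w f" if "f \<in> P - Q" for f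
        using P(1) planar_matching_K_nn that nonneg by blast
    qed (rule Q(1))
    finally show "Min (matching_weight w ` ?S) \<le> Min (matching_weight w ` ?T)" using P(2) by simp
  qed
  then show ?thesis unfolding min_weight_def .
qed

lemma
  assumes "\<And>f. f \<in> K_nn n \<Longrightarrow> 0 \<le> w f" "0 \<le> \<tau>" "\<tau> \<le> real n"
  shows min_weight_attained:
      "\<exists>P. planar_matching n P \<and> card P = nat \<lceil>\<tau>\<rceil> \<and> min_weight n \<tau> w = matching_weight w P"
    and min_weight_le:
      "planar_matching n P \<Longrightarrow> card P = nat \<lceil>\<tau>\<rceil> \<Longrightarrow> min_weight n \<tau> w \<le> matching_weight w P"
proof -
  let ?S = "{P. planar_matching n P \<and> card P = nat \<lceil>\<tau>\<rceil>}"
  have eq: "min_weight n \<tau> w = Min (matching_weight w ` ?S)"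
    using assms by (rule min_weight_eq_Min)
  have fin: "finite ?S" by (rule finite_subset[OF _ finite_planar_matchings]) auto
  have "nat \<lceil>\<tau>\<rceil> \<le> n" using assms(3) by (simp add: nat_le_iff ceiling_le_iff)
  then have "?S \<noteq> {}" using ex_planar_matching by auto
  then have "Min (matching_weight w ` ?S) \<in> matching_weight w ` ?S"
    using fin by (intro Min_in) auto
  then show "\<exists>P. planar_matching n P \<and> card P = nat \<lceil>\<tau>\<rceil> \<and> min_weight n \<tau> w = matching_weight w P"
    using eq by auto
  show "min_weight n \<tau> w \<le> matching_weight w P" if "planar_matching n P" "card P = nat \<lceil>\<tau>\<rceil>"
    unfolding eq using that fin by (intro Min_le) auto
qed

text \<open>A planar matching is recovered from its two vertex sets, since it matches vertices of equal rank.\<close>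
lemma inj_on_planar_matching_vertices:
  "inj_on (\<lambda>P. (fst ` P, snd ` P)) {P. planar_matching n P}"
proof -
  have rank: "card {x \<in> fst ` P. x < a} = card {y \<in> snd ` P. y < b}"
    if P: "planar_matching n P" and ab: "(a, b) \<in> P" for P a b
  proof -
    have less: "fst p < a \<longleftrightarrow> snd p < b" if "p \<in> P" for p
      using planar_matching_chain[OF P that ab] by (cases "p = (a, b)") auto
    have "{x \<in> fst ` P. x < a} = fst ` {p \<in> P. fst p < a}"
      "{y \<in> snd ` P. y < b} = snd ` {p \<in> P. fst p < a}"
      using less by auto
    moreover have "inj_on fst {p \<in> P. fst p < a}" "inj_on snd {p \<in> P. fst p < a}"
      using planar_matching_inj_on[OF P] by (auto intro: inj_on_subset)
    ultimately show ?thesis by (simp add: card_image)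
  qed
  have subset: "P \<subseteq> Q" if P: "planar_matching n P" and Q: "planar_matching n Q"
    and eq: "fst ` P = fst ` Q" "snd ` P = snd ` Q" for P Q
  proof
    fix p assume p: "p \<in> P"
    then obtain a b where ab: "p = (a, b)" by (cases p)
    with p eq have "a \<in> fst ` Q" by force
    then obtain c where c: "(a, c) \<in> Q" by auto
    have "card {y \<in> snd ` Q. y < b} = card {y \<in> snd ` Q. y < c}"
      using rank[OF P] rank[OF Q c] p ab eq by metis
    moreover have "b \<in> snd ` Q" "c \<in> snd ` Q" using p ab eq c by force+
    moreover have "finite (snd ` Q)" using planar_matching_finite[OF Q] by simp
    ultimately have "b = c"
    proof (cases b c rule: linorder_cases)
      case less
      then have "{y \<in> snd ` Q. y < b} \<subset> {y \<in> snd ` Q. y < c}"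
        using \<open>b \<in> snd ` Q\<close> by auto
      then have "card {y \<in> snd ` Q. y < b} < card {y \<in> snd ` Q. y < c}"
        using \<open>finite (snd ` Q)\<close> by (intro psubset_card_mono) auto
      then show ?thesis
        using \<open>card {y \<in> snd ` Q. y < b} = _\<close> by linarith
    next
      case greater
      then have "{y \<in> snd ` Q. y < c} \<subset> {y \<in> snd ` Q. y < b}"
        using \<open>c \<in> snd ` Q\<close> by auto
      then have "card {y \<in> snd ` Q. y < c} < card {y \<in> snd ` Q. y < b}"
        using \<open>finite (snd ` Q)\<close> by (intro psubset_card_mono) auto
      then show ?thesis
        using \<open>card {y \<in> snd ` Q. y < b} = _\<close> by linarith
    qed
    then show "p \<in> Q" using c ab by simp
  qed
  show ?thesis
  proof (rule inj_onI)
    fix P Q assume "P \<in> {P. planar_matching n P}" "Q \<in> {P. planar_matching n P}"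
      and "(fst ` P, snd ` P) = (fst ` Q, snd ` Q)"
    then show "P = Q" using subset[of P Q] subset[of Q P] by auto
  qed
qed

text \<open>Each matching is encoded injectively by two \<open>k\<close>-subsets of
  \<open>{1..n}\<close>. The square here is balanced by the square in \<open>s_val\<close>.\<close>

lemma card_planar_matchings_le: "card {P. planar_matching n P \<and> card P = k} \<le> (n choose k)\<^sup>2"
proof -
  let ?S = "{P. planar_matching n P \<and> card P = k}" and ?B = "{B. B \<subseteq> {1..n} \<and> card B = k}"
  have "(\<lambda>P. (fst ` P, snd ` P)) ` ?S \<subseteq> ?B \<times> ?B"
  proof
    fix z assume "z \<in> (\<lambda>P. (fst ` P, snd ` P)) ` ?S"
    then obtain P where P: "planar_matching n P" "card P = k" "z = (fst ` P, snd ` P)" by auto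
    have "inj_on fst P" "inj_on snd P"
      using planar_matching_inj_on[OF P(1)] .
    then show "z \<in> ?B \<times> ?B"
      using P planar_matching_K_nn[OF P(1)] by (auto simp: card_image K_nn_def)
  qed
  moreover have "inj_on (\<lambda>P. (fst ` P, snd ` P)) ?S"
    by (rule inj_on_subset[OF inj_on_planar_matching_vertices]) auto
  ultimately have "card ?S \<le> card (?B \<times> ?B)"
    by (intro card_inj_on_le[of _ ?S]) auto
  also have "card ?B = n choose k"
    using n_subsets[of "{1..n}" k] by simp
  then have "card (?B \<times> ?B) = (n choose k)\<^sup>2"
    by (simp add: card_cartesian_product power2_eq_square)
  finally show ?thesis .
qed

section \<open>Diagonal blocks\<close>

text \<open>Blocks are numbered from 0 and vertices from 1, hence intervals open on the left. Since
  the blocks lie along the diagonal, edges from different blocks never cross.\<close>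

definition block :: "nat \<Rightarrow> nat \<Rightarrow> (nat \<times> nat) set" where
  "block L b = {b * L<..b * L + L} \<times> {b * L<..b * L + L}"

lemma finite_block [simp]: "finite (block L b)"
  and card_block: "card (block L b) = L\<^sup>2"
  by (simp_all add: block_def power2_eq_square)

lemma block_less:
  assumes "p \<in> block L b" "q \<in> block L c" "b < c"
  shows "fst p < fst q" "snd p < snd q"
proof -
  have "b * L + L \<le> c * L"
    using mult_le_mono1[of "Suc b" c L] assms(3) by simp
  then show "fst p < fst q" "snd p < snd q"
    using assms by (auto simp: block_def)
qed

lemma disjoint_block: "b \<noteq> c \<Longrightarrow> block L b \<inter> block L c = {}"
  using block_less by (metis disjoint_iff less_irrefl linorder_neqE_nat)

lemma block_K_nn:
  assumes "k * L \<le> n" "b < k"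
  shows "block L b \<subseteq> K_nn n"
proof -
  have "b * L + L \<le> n"
    using mult_le_mono1[of "Suc b" k L] assms by simp
  then show ?thesis by (auto simp: block_def K_nn_def)
qed

lemma planar_matching_blocks:
  assumes "k * L \<le> n" "B \<subseteq> {..<k}" "\<And>b. b \<in> B \<Longrightarrow> e b \<in> block L b"
  shows "planar_matching n (e ` B)" "card (e ` B) = card B"
proof -
  show "planar_matching n (e ` B)"
    unfolding planar_matching_iff
  proof (intro conjI ballI impI)
    show "e ` B \<subseteq> K_nn n" using assms block_K_nn[OF assms(1)] by blast
    fix p q assume "p \<in> e ` B" "q \<in> e ` B" "p \<noteq> q"
    then obtain b c where "b \<in> B" "c \<in> B" "p = e b" "q = e c" "b \<noteq> c" by auto
    then show "fst p < fst q \<and> snd p < snd q \<or> fst q < fst p \<and> snd q < snd p"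
      using assms(3) block_less by (metis linorder_neqE_nat)
  qed
  have "inj_on e B"
    using assms(3) disjoint_block by (metis disjoint_iff inj_onI)
  then show "card (e ` B) = card B" by (rule card_image)
qed

lemma min_weight_cong:
  assumes "\<And>f. f \<in> K_nn n \<Longrightarrow> w f = w' f"
  shows "min_weight n \<tau> w = min_weight n \<tau> w'"
  unfolding min_weight_def matching_weight_def
proof (intro arg_cong[of _ _ Min] image_cong sum.cong refl)
  fix P f assume "P \<in> {P. planar_matching n P \<and> \<tau> \<le> real (card P)}" "f \<in> P"
  then show "w f = w' f" using planar_matching_K_nn assms by blast
qed

subsection \<open>Tail bounds for the minimum weight\<close>

text \<open>The quotient \<open>k ^ k / fact k\<close> is a single term of the exponential series at
  \<open>k\<close>. This is the bound k! \<ge> (k / e)^k.\<close>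

lemma power_le_fact_exp: "real k ^ k \<le> fact k * exp (real k)"
proof -
  have "(\<lambda>n. real k ^ n / fact n) sums exp (real k)"
    using exp_converges[of "real k"] by (simp add: divide_inverse mult.commute)
  moreover from this have "(\<Sum>n\<in>{k}. real k ^ n / fact n) \<le> (\<Sum>n. real k ^ n / fact n)"
    by (intro sum_le_suminf sums_summable) auto
  ultimately have "real k ^ k / fact k \<le> exp (real k)"
    by (simp add: sums_unique[symmetric])
  then show ?thesis by (simp add: divide_le_eq mult.commute)
qed

text \<open>Here (n choose k) \<le> (e n / k)^k meets \<tau> / (64 n) \<le> k / (32 n). The base is
  then e / 32, which is at most 1 / e because e^2 \<le> 9.\<close>

lemma choose_mult_power_le:
  assumes "0 < n" "0 < k" "0 \<le> \<tau>" "\<tau> \<le> 2 * real k"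
  shows "real (n choose k) * (\<tau> / (64 * real n)) ^ k \<le> exp (- real k)"
proof -
  have "real (n choose k) * fact k \<le> real n ^ k"
    using binomial_fact_pow[of n k] by (metis of_nat_fact of_nat_le_iff of_nat_mult of_nat_power)
  then have "real (n choose k) * (fact k * exp (real k)) \<le> real n ^ k * exp (real k)"
    by (simp add: mult.assoc[symmetric])
  moreover have "real (n choose k) * real k ^ k \<le> real (n choose k) * (fact k * exp (real k))"
    by (intro mult_left_mono power_le_fact_exp) auto
  ultimately have "real (n choose k) * real k ^ k \<le> real n ^ k * exp (real k)" by linarith
  moreover have "exp (real k) = exp 1 ^ k"
    using exp_of_nat_mult[of k "1 :: real"] by (simp only: mult_1_right)
  ultimately have *: "real (n choose k) * real k ^ k \<le> (real n * exp 1) ^ k"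
    by (simp only: power_mult_distrib)
  have e: "exp 1 * exp 1 \<le> (32 :: real)"
    using mult_mono[OF exp_le exp_le] by simp
  have "real (n choose k) * (\<tau> / (64 * real n)) ^ k \<le> real (n choose k) * (real k / (32 * real n)) ^ k"
    using assms by (intro mult_left_mono power_mono) (auto simp: field_simps)
  also have "\<dots> = (real (n choose k) * real k ^ k) / (32 * real n) ^ k"
    by (simp add: power_divide)
  also have "\<dots> \<le> (real n * exp 1) ^ k / (32 * real n) ^ k"
    by (intro divide_right_mono *) auto
  also have "\<dots> = (exp 1 / 32) ^ k"
    unfolding power_divide[symmetric] using assms(1) by simp
  also have "\<dots> \<le> exp (- 1) ^ k"
    using e by (intro power_mono) (auto simp: exp_minus field_simps)
  also have "\<dots> = exp (- real k)"
    using exp_of_nat_mult[of k "- 1 :: real"] by simp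
  finally show ?thesis .
qed

lemma borel_measurable_min_weight:
  assumes "\<And>f. f \<in> K_nn n \<Longrightarrow> X f \<in> borel_measurable M"
  shows "(\<lambda>\<omega>. min_weight n \<tau> (\<lambda>f. X f \<omega>)) \<in> borel_measurable M"
  unfolding min_weight_def matching_weight_def
proof (rule borel_measurable_Min)
  show "finite {P. planar_matching n P \<and> \<tau> \<le> real (card P)}"
    by (rule finite_subset[OF _ finite_planar_matchings]) auto
  fix P assume "P \<in> {P. planar_matching n P \<and> \<tau> \<le> real (card P)}"
  then show "(\<lambda>\<omega>. \<Sum>f\<in>P. X f \<omega>) \<in> borel_measurable M"
    using planar_matching_K_nn assms by (intro borel_measurable_sum) blast
qed

text \<open>An edge is light when \<open>X f \<omega> < s\<close>, strictly: below the infimum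
  \<open>s_val\<close> the distribution functions are small, while at that point they may
  jump.\<close>

lemma (in prob_space) min_weight_lower_tail:
  fixes X :: "nat \<times> nat \<Rightarrow> 'a \<Rightarrow> real"
  assumes indep: "indep_vars (\<lambda>_. borel) X (K_nn n)"
    and nonneg: "\<And>f \<omega>. f \<in> K_nn n \<Longrightarrow> 0 \<le> X f \<omega>"
    and \<tau>: "1 \<le> \<tau>" "\<tau> \<le> real n" and s: "0 \<le> s"
    and p: "\<And>f. f \<in> K_nn n \<Longrightarrow> prob {\<omega> \<in> space M. X f \<omega> < s} \<le> (\<tau> / (64 * real n))\<^sup>2"
  shows "prob {\<omega> \<in> space M. min_weight n \<tau> (\<lambda>f. X f \<omega>) < \<tau> * s / 2} \<le> exp (- \<tau>)"
proof -
  \<comment> \<open>Exactly \<open>k\<close> light edges are kept, so that the union bound runs over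
    a single size; \<open>2 * k \<ge> \<tau>\<close> finally turns the square of
    \<open>exp (- k)\<close> into at most \<open>exp (- \<tau>)\<close>.\<close>
  define k where "k = nat \<lceil>\<tau> / 2\<rceil>"
  define q where "q = \<tau> / (64 * real n)"
  define S where "S = {P. planar_matching n P \<and> card P = k}"
  define A where "A P = (\<Inter>f\<in>P. X f -` {..<s} \<inter> space M)" for P
  have k: "\<tau> \<le> 2 * real k" "0 < k"
    using \<tau> unfolding k_def by linarith+
  have X [measurable]: "X f \<in> borel_measurable M" if "f \<in> K_nn n" for f
    using indep that by (auto simp: indep_vars_def)
  have "finite S" unfolding S_def by (rule finite_subset[OF _ finite_planar_matchings]) auto
  have S: "P \<noteq> {}" "finite P" "P \<subseteq> K_nn n" "card P = k" if "P \<in> S" for P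
    using that k planar_matching_finite planar_matching_K_nn unfolding S_def by auto
  have A_sets: "A P \<in> events" if "P \<in> S" for P
    unfolding A_def using S[OF that] by (intro sets.finite_INT measurable_sets[OF X]) auto
  have A_prob: "prob (A P) \<le> q ^ (2 * k)" if "P \<in> S" for P
  proof -
    have "prob (A P) = (\<Prod>f\<in>P. prob (X f -` {..<s} \<inter> space M))"
      unfolding A_def using S[OF that] by (intro indep_varsD[OF indep]) auto
    also have "\<dots> \<le> (\<Prod>f\<in>P. q\<^sup>2)"
    proof (intro prod_mono conjI)
      fix f assume "f \<in> P"
      then have "f \<in> K_nn n" using S[OF that] by auto
      from p[OF this] show "prob (X f -` {..<s} \<inter> space M) \<le> q\<^sup>2"
        by (simp add: q_def vimage_def Int_def conj_commute)
    qed simp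
    also have "\<dots> = q ^ (2 * k)" using S(4)[OF that] by (simp add: power_mult)
    finally show ?thesis .
  qed
  have "{\<omega> \<in> space M. min_weight n \<tau> (\<lambda>f. X f \<omega>) < \<tau> * s / 2} \<subseteq> (\<Union>P\<in>S. A P)"
  proof
    fix \<omega> assume "\<omega> \<in> {\<omega> \<in> space M. min_weight n \<tau> (\<lambda>f. X f \<omega>) < \<tau> * s / 2}"
    then have \<omega>: "\<omega> \<in> space M" "min_weight n \<tau> (\<lambda>f. X f \<omega>) < \<tau> * s / 2" by auto
    obtain P where P: "planar_matching n P" "card P = nat \<lceil>\<tau>\<rceil>"
      "min_weight n \<tau> (\<lambda>f. X f \<omega>) = matching_weight (\<lambda>f. X f \<omega>) P"
      using min_weight_attained[of n "\<lambda>f. X f \<omega>" \<tau>] nonneg \<tau> by auto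
    note fin = planar_matching_finite[OF P(1)] and sub = planar_matching_K_nn[OF P(1)]
    define Q where "Q = {f \<in> P. X f \<omega> < s}"
    have Q: "Q \<subseteq> P" by (auto simp: Q_def)
    have "s * real (card (P - Q)) = (\<Sum>f\<in>P - Q. s)" by simp
    also have "\<dots> \<le> (\<Sum>f\<in>P - Q. X f \<omega>)" by (intro sum_mono) (auto simp: Q_def)
    also have "\<dots> \<le> (\<Sum>f\<in>P. X f \<omega>)" using fin sub nonneg by (intro sum_mono2) auto
    also have "\<dots> < \<tau> * s / 2" using \<omega> P(3) by (simp add: matching_weight_def)
    finally have lt: "s * real (card (P - Q)) < \<tau> * s / 2" .
    \<comment> \<open>Argued by contradiction because \<open>s\<close> may be 0 and cannot be
      divided by; in that case the strict inequality \<open>lt\<close> is already absurd.\<close>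
    have "real (card (P - Q)) < \<tau> / 2"
    proof (rule ccontr)
      assume "\<not> ?thesis"
      then have "s * (\<tau> / 2) \<le> s * real (card (P - Q))"
        using s by (intro mult_left_mono) auto
      with lt show False by (simp add: mult.commute)
    qed
    moreover have "real (card P) = real (card Q) + real (card (P - Q))"
      using card_Diff_subset[OF finite_subset[OF Q fin] Q] card_mono[OF fin Q] by simp
    moreover have "\<tau> \<le> real (card P)" unfolding P(2) by linarith
    ultimately have "\<tau> / 2 \<le> real (card Q)" by linarith
    then have "k \<le> card Q" unfolding k_def by linarith
    then obtain R where R: "R \<subseteq> Q" "card R = k" by (rule obtain_subset_with_card_n)
    then have "R \<in> S"
      unfolding S_def using planar_matching_subset[OF P(1)] Q by auto
    moreover have "\<omega> \<in> A R"
      using R \<omega>(1) S(1)[OF \<open>R \<in> S\<close>] unfolding A_def Q_def by auto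
    ultimately show "\<omega> \<in> (\<Union>P\<in>S. A P)" by auto
  qed
  then have "prob {\<omega> \<in> space M. min_weight n \<tau> (\<lambda>f. X f \<omega>) < \<tau> * s / 2} \<le> prob (\<Union>P\<in>S. A P)"
    using \<open>finite S\<close> A_sets by (intro finite_measure_mono sets.finite_UN) auto
  also have "\<dots> \<le> (\<Sum>P\<in>S. prob (A P))"
    using \<open>finite S\<close> A_sets by (intro finite_measure_subadditive_finite) auto
  also have "\<dots> \<le> real (card S) * q ^ (2 * k)"
    using sum_mono[of S "\<lambda>P. prob (A P)" "\<lambda>_. q ^ (2 * k)"] A_prob by simp
  also have "\<dots> \<le> real ((n choose k)\<^sup>2) * q ^ (2 * k)"
    using card_planar_matchings_le[of n k] unfolding S_def of_nat_le_iff[symmetric, where 'a=real]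
    by (intro mult_right_mono) auto
  also have "\<dots> = (real (n choose k) * q ^ k)\<^sup>2"
    by (simp add: power_mult_distrib power_mult[symmetric] mult.commute)
  also have "\<dots> \<le> (exp (- real k))\<^sup>2"
    using choose_mult_power_le[of n k \<tau>] k \<tau> unfolding q_def by (intro power_mono) auto
  also have "\<dots> = exp (- (2 * real k))"
    using exp_of_nat_mult[of 2 "- real k"] by simp
  also have "\<dots> \<le> exp (- \<tau>)" using k by simp
  finally show ?thesis .
qed

text \<open>The factor 2 in \<open>2 * \<tau> * x\<close> absorbs the rounding of
  \<open>\<tau>\<close> up to \<open>m \<le> 2 * \<tau>\<close>.\<close>

lemma (in prob_space) min_weight_upper_tail:
  fixes X :: "nat \<times> nat \<Rightarrow> 'a \<Rightarrow> real"
  assumes indep: "indep_vars (\<lambda>_. borel) X (K_nn n)"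
    and nonneg: "\<And>f \<omega>. f \<in> K_nn n \<Longrightarrow> 0 \<le> X f \<omega>"
    and \<tau>: "1 \<le> \<tau>" "8 * \<tau> < real n" and x: "0 \<le> x"
    and p: "\<And>f. f \<in> K_nn n \<Longrightarrow> (8 * \<tau> / real n)\<^sup>2 \<le> prob {\<omega> \<in> space M. X f \<omega> \<le> x}"
  shows "prob {\<omega> \<in> space M. 2 * \<tau> * x < min_weight n \<tau> (\<lambda>f. X f \<omega>)} \<le> exp (- \<tau> / 3)"
proof -
  define m where "m = nat \<lceil>\<tau>\<rceil>"
  \<comment> \<open>If fewer than \<open>m\<close> of the \<open>2 m\<close> disjoint diagonal blocks of side \<open>L\<close> contain an edge of weight
    at most \<open>x\<close>, then \<open>m\<close> of them contain none; there are at most \<open>4 ^ m\<close> choices of these.\<close>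
  define L where "L = n div (2 * m)"
  define r where "r = (8 * \<tau> / real n)\<^sup>2"
  define S where "S = {B. B \<subseteq> {..<2 * m} \<and> card B = m}"
  define U where "U B = (\<Union>b\<in>B. block L b)" for B
  define A where "A B = (\<Inter>f\<in>U B. X f -` {x<..} \<inter> space M)" for B
  have m: "\<tau> \<le> real m" "real m < \<tau> + 1" "0 < m"
    using \<tau> unfolding m_def by linarith+
  have "4 * real m < real n" using m \<tau> by linarith
  then have "4 * m < n" by linarith
  then have L2: "2 \<le> L"
    unfolding L_def using m by (simp add: less_eq_div_iff_mult_less_eq)
  have Ln: "2 * m * L \<le> n" unfolding L_def by simp
  \<comment> \<open>The rounding loss in \<open>L\<close>: since \<open>L \<ge> 2\<close>, the
    remainder is less than \<open>2 * m \<le> m * L\<close>, so n \<le> 3 m L \<le> 6 \<tau> L.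
    Multiplying the L^2 edges of a block by (8 \<tau> / n)^2 then gives at least (8 / 6)^2 = 16 /
    9.\<close>
  have 1: "n < 2 * m * L + 2 * m"
    unfolding L_def using m dividend_less_times_div[of "2 * m" n] by simp
  have "m * 2 \<le> m * L" using L2 by (rule mult_le_mono2)
  with 1 have "n \<le> 3 * m * L" unfolding mult.assoc by linarith
  then have "real n \<le> 3 * real m * real L"
    by (metis of_nat_le_iff of_nat_mult of_nat_numeral)
  also have "\<dots> \<le> 3 * (2 * \<tau>) * real L"
    using m \<tau> by (intro mult_right_mono mult_left_mono) auto
  finally have "4 / 3 \<le> 8 * \<tau> * real L / real n"
    using \<tau> by (simp add: field_simps)
  then have "(4 / 3)\<^sup>2 \<le> (8 * \<tau> * real L / real n)\<^sup>2"
    by (intro power_mono) auto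
  then have rL: "16 / 9 \<le> r * (real L)\<^sup>2"
    by (simp add: r_def power_divide power_mult_distrib)
  have X [measurable]: "X f \<in> borel_measurable M" if "f \<in> K_nn n" for f
    using indep that by (auto simp: indep_vars_def)
  have "finite S" by (simp add: S_def)
  have U: "U B \<noteq> {}" "finite (U B)" "U B \<subseteq> K_nn n" "card (U B) = m * L\<^sup>2" if "B \<in> S" for B
  proof -
    have B: "B \<subseteq> {..<2 * m}" "card B = m" "finite B"
      using that finite_subset[of B "{..<2 * m}"] by (auto simp: S_def)
    show "finite (U B)" using B by (simp add: U_def)
    show "U B \<subseteq> K_nn n" unfolding U_def using B block_K_nn[OF Ln] by blast
    have "card (U B) = (\<Sum>b\<in>B. card (block L b))"
      unfolding U_def using B disjoint_block by (intro card_UN_disjoint) auto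
    then show c: "card (U B) = m * L\<^sup>2" by (simp add: card_block B)
    show "U B \<noteq> {}" using c m L2 by (metis card.empty mult_is_0 not_less_zero not_numeral_le_zero power_eq_0_iff)
  qed
  have A_sets: "A B \<in> events" if "B \<in> S" for B
    unfolding A_def using U[OF that] by (intro sets.finite_INT measurable_sets[OF X]) auto
  have A_prob: "prob (A B) \<le> exp (- (16 / 9 * real m))" if B: "B \<in> S" for B
  proof -
    have "prob (A B) = (\<Prod>f\<in>U B. prob (X f -` {x<..} \<inter> space M))"
      unfolding A_def using U[OF B] by (intro indep_varsD[OF indep]) auto
    also have "\<dots> \<le> (\<Prod>f\<in>U B. exp (- r))"
    proof (intro prod_mono conjI)
      fix f assume "f \<in> U B"
      then have f: "f \<in> K_nn n" using U[OF B] by auto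
      have "X f -` {x<..} \<inter> space M = space M - {\<omega> \<in> space M. X f \<omega> \<le> x}" by auto
      then have "prob (X f -` {x<..} \<inter> space M) = 1 - prob {\<omega> \<in> space M. X f \<omega> \<le> x}"
        using X[OF f] by (simp add: prob_compl)
      also have "\<dots> \<le> 1 - r" using p[OF f] by (simp add: r_def)
      also have "\<dots> \<le> exp (- r)" using exp_ge_add_one_self[of "- r"] by simp
      finally show "prob (X f -` {x<..} \<inter> space M) \<le> exp (- r)" .
    qed simp
    also have "\<dots> = exp (- (real m * (r * (real L)\<^sup>2)))"
      using exp_of_nat_mult[of "m * L\<^sup>2" "- r"] U(4)[OF B] by (simp add: mult_ac)
    also have "\<dots> \<le> exp (- (16 / 9 * real m))"
      using mult_left_mono[OF rL, of "real m"] by (simp add: mult.commute)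
    finally show ?thesis .
  qed
  have "{\<omega> \<in> space M. 2 * \<tau> * x < min_weight n \<tau> (\<lambda>f. X f \<omega>)} \<subseteq> (\<Union>B\<in>S. A B)"
  proof
    fix \<omega> assume "\<omega> \<in> {\<omega> \<in> space M. 2 * \<tau> * x < min_weight n \<tau> (\<lambda>f. X f \<omega>)}"
    then have \<omega>: "\<omega> \<in> space M" "2 * \<tau> * x < min_weight n \<tau> (\<lambda>f. X f \<omega>)" by auto
    define H where "H = {b \<in> {..<2 * m}. \<exists>f\<in>block L b. X f \<omega> \<le> x}"
    have H: "H \<subseteq> {..<2 * m}" by (auto simp: H_def)
    have "card H < m"
    proof (rule ccontr)
      assume "\<not> card H < m"
      then have "m \<le> card H" by simp
      then obtain B where B: "B \<subseteq> H" "card B = m" by (rule obtain_subset_with_card_n)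
      have "\<forall>b\<in>B. \<exists>f. f \<in> block L b \<and> X f \<omega> \<le> x" using B(1) unfolding H_def by blast
      then obtain e where e: "\<And>b. b \<in> B \<Longrightarrow> e b \<in> block L b" "\<And>b. b \<in> B \<Longrightarrow> X (e b) \<omega> \<le> x"
        by metis
      have pm: "planar_matching n (e ` B)" "card (e ` B) = card B"
        using planar_matching_blocks[OF Ln, of B e] B H e by auto
      have "min_weight n \<tau> (\<lambda>f. X f \<omega>) \<le> matching_weight (\<lambda>f. X f \<omega>) (e ` B)"
        using pm B \<tau> nonneg by (intro min_weight_le) (auto simp: m_def)
      also have "\<dots> \<le> (\<Sum>f\<in>e ` B. x)"
        unfolding matching_weight_def using e by (intro sum_mono) auto
      also have "\<dots> = real m * x" using pm B by simp
      also have "\<dots> \<le> 2 * \<tau> * x" using m \<tau> x by (intro mult_right_mono) auto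
      finally show False using \<omega> by simp
    qed
    then have "m \<le> card ({..<2 * m} - H)"
      using card_Diff_subset[OF finite_subset[OF H] H] by simp
    then obtain B where B: "B \<subseteq> {..<2 * m} - H" "card B = m" by (rule obtain_subset_with_card_n)
    then have "B \<in> S" by (auto simp: S_def)
    moreover have "\<omega> \<in> A B"
    proof -
      have "x < X f \<omega>" if "b \<in> B" "f \<in> block L b" for b f
      proof (rule ccontr)
        assume "\<not> ?thesis"
        then have "X f \<omega> \<le> x" by simp
        then have "b \<in> H" using that B(1) unfolding H_def by blast
        then show False using that B(1) by blast
      qed
      then show ?thesis
        using \<omega>(1) U(1)[OF \<open>B \<in> S\<close>] unfolding A_def U_def by auto
    qed
    ultimately show "\<omega> \<in> (\<Union>B\<in>S. A B)" by auto
  qed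
  then have "prob {\<omega> \<in> space M. 2 * \<tau> * x < min_weight n \<tau> (\<lambda>f. X f \<omega>)} \<le> prob (\<Union>B\<in>S. A B)"
    using \<open>finite S\<close> A_sets by (intro finite_measure_mono sets.finite_UN) auto
  also have "\<dots> \<le> (\<Sum>B\<in>S. prob (A B))"
    using \<open>finite S\<close> A_sets by (intro finite_measure_subadditive_finite) auto
  also have "\<dots> \<le> real (card S) * exp (- (16 / 9 * real m))"
    using sum_mono[of S "\<lambda>P. prob (A P)" "\<lambda>_. exp (- (16 / 9 * real m))"] A_prob by simp
  \<comment> \<open>The number of choices is at most 4^m, and ln 2 \<le> 25 / 36 gives the exponent
    25 / 18. What survives is 16 / 9 - 25 / 18 = 7 / 18, which exceeds 1 / 3.\<close>
  also have "\<dots> \<le> exp (25 / 18 * real m) * exp (- (16 / 9 * real m))"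
  proof (intro mult_right_mono)
    have "card S = (2 * m) choose m"
      using n_subsets[of "{..<2 * m}" m] by (simp add: S_def)
    also have "\<dots> \<le> 2 ^ (2 * m)" by (rule binomial_le_pow2)
    finally have "real (card S) \<le> 2 ^ (2 * m)"
      by (metis of_nat_le_iff of_nat_numeral of_nat_power)
    also have "\<dots> = exp (real (2 * m) * ln 2)"
      using exp_of_nat_mult[of "2 * m" "ln 2 :: real"] by simp
    also have "\<dots> \<le> exp (25 / 18 * real m)"
      using mult_left_mono[OF ln2_le_25_over_36, of "2 * real m"] by simp
    finally show "real (card S) \<le> exp (25 / 18 * real m)" .
  qed simp
  also have "\<dots> \<le> exp (- \<tau> / 3)"
    unfolding exp_add[symmetric] using m \<tau> by simp
  finally show ?thesis .
qed

text \<open>The contribution of the exceptional event is controlled by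
  \<open>2 X 1 \<le> \<delta> X\<^sup>2 + 1 / \<delta>\<close>, the indicator of the event having probability at most \<open>\<delta>\<^sup>2\<close>.\<close>
lemma (in prob_space) expectation_le_truncated:
  fixes X :: "'i \<Rightarrow> 'a \<Rightarrow> real"
  assumes Y [measurable]: "Y \<in> borel_measurable M" and Y_nonneg: "\<And>\<omega>. 0 \<le> Y \<omega>"
    and Y_le: "\<And>\<omega>. Y \<omega> \<le> (\<Sum>i\<in>K. X i \<omega>)"
    and square: "\<And>i. i \<in> K \<Longrightarrow> integrable M (\<lambda>\<omega>. (X i \<omega>)\<^sup>2)"
    and C: "\<And>i. i \<in> K \<Longrightarrow> expectation (\<lambda>\<omega>. (X i \<omega>)\<^sup>2) \<le> C"
    and a: "0 \<le> a" and \<delta>: "0 < \<delta>" "prob {\<omega> \<in> space M. a < Y \<omega>} \<le> \<delta>\<^sup>2"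
  shows "expectation Y \<le> a + real (card K) * ((C + 1) / 2 * \<delta>)"
proof -
  let ?B = "{\<omega> \<in> space M. a < Y \<omega>}"
  let ?Z = "\<lambda>i \<omega>. \<delta> / 2 * (X i \<omega>)\<^sup>2 + indicator ?B \<omega> / (2 * \<delta>)"
  have [measurable]: "?B \<in> events" by measurable
  have int_B: "integrable M (indicator ?B :: 'a \<Rightarrow> real)"
    by (rule integrable_const_bound[where B=1]) (auto simp: indicator_def)
  have int_Z: "integrable M (?Z i)" if "i \<in> K" for i
    using square[OF that] int_B by (intro Bochner_Integration.integrable_add) auto
  have "expectation Y \<le> expectation (\<lambda>\<omega>. a + (\<Sum>i\<in>K. ?Z i \<omega>))"
  proof (rule integral_mono')
    show "integrable M (\<lambda>\<omega>. a + (\<Sum>i\<in>K. ?Z i \<omega>))"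
      by (intro Bochner_Integration.integrable_add Bochner_Integration.integrable_sum int_Z) auto
    fix \<omega> assume \<omega>: "\<omega> \<in> space M"
    have Z_nonneg: "0 \<le> ?Z i \<omega>" for i
      using \<delta> by (intro add_nonneg_nonneg mult_nonneg_nonneg divide_nonneg_nonneg) auto
    have sum_nonneg: "0 \<le> (\<Sum>i\<in>K. ?Z i \<omega>)" by (intro sum_nonneg Z_nonneg)
    show "Y \<omega> \<le> a + (\<Sum>i\<in>K. ?Z i \<omega>)"
    proof (cases "a < Y \<omega>")
      case True
      have "X i \<omega> \<le> ?Z i \<omega>" for i
      proof -
        have "2 * \<delta> * X i \<omega> \<le> (\<delta> * X i \<omega>)\<^sup>2 + 1"
          using sum_squares_bound[of "\<delta> * X i \<omega>" 1] by simp
        then have "X i \<omega> \<le> ((\<delta> * X i \<omega>)\<^sup>2 + 1) / (2 * \<delta>)"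
          using \<delta>(1) by (simp add: le_divide_eq mult_ac)
        also have "\<dots> = \<delta> / 2 * (X i \<omega>)\<^sup>2 + 1 / (2 * \<delta>)"
          using \<delta>(1) by (simp add: add_divide_distrib power2_eq_square)
        finally show ?thesis using True \<omega> by simp
      qed
      then have "(\<Sum>i\<in>K. X i \<omega>) \<le> (\<Sum>i\<in>K. ?Z i \<omega>)" by (rule sum_mono)
      then show ?thesis using Y_le[of \<omega>] a by linarith
    qed (use sum_nonneg in linarith)
    show "0 \<le> a + (\<Sum>i\<in>K. ?Z i \<omega>)" using a sum_nonneg by linarith
  qed
  also have "\<dots> = a + (\<Sum>i\<in>K. expectation (?Z i))"
    using int_Z by (simp add: prob_space Bochner_Integration.integrable_sum)
  also have "(\<Sum>i\<in>K. expectation (?Z i)) \<le> (\<Sum>i\<in>K. (C + 1) / 2 * \<delta>)"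
  proof (rule sum_mono)
    fix i assume i: "i \<in> K"
    have "expectation (?Z i) = \<delta> / 2 * expectation (\<lambda>\<omega>. (X i \<omega>)\<^sup>2) + prob ?B / (2 * \<delta>)"
      using square[OF i] int_B by simp
    also have "\<dots> \<le> \<delta> / 2 * C + \<delta>\<^sup>2 / (2 * \<delta>)"
      using C[OF i] \<delta> by (intro add_mono mult_left_mono divide_right_mono) auto
    also have "\<dots> = (C + 1) / 2 * \<delta>"
      using \<delta>(1) by (simp add: power2_eq_square field_simps)
    finally show "expectation (?Z i) \<le> (C + 1) / 2 * \<delta>" .
  qed
  finally show ?thesis by simp
qed

subsection \<open>The thresholds\<close>

text \<open>Continuity from above along the events X \<le> 1 / (n + 1), there being no mass at or
  below 0. It provides a member of the set whose supremum is \<open>t_val\<close>.\<close>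

lemma (in prob_space) cdf_tendsto_zero:
  fixes X :: "'a \<Rightarrow> real"
  assumes X [measurable]: "X \<in> borel_measurable M" and "prob {\<omega> \<in> space M. X \<omega> \<le> 0} = 0" and "0 < r"
  shows "\<exists>x>0. prob {\<omega> \<in> space M. X \<omega> \<le> x} \<le> r"
proof -
  let ?A = "\<lambda>n. {\<omega> \<in> space M. X \<omega> \<le> inverse (real (Suc n))}"
  have "(\<lambda>n. prob (?A n)) \<longlonglongrightarrow> prob (\<Inter>n. ?A n)"
  proof (rule finite_Lim_measure_decseq)
    show "range ?A \<subseteq> events" by auto
    show "decseq ?A"
    proof (rule decseq_SucI)
      fix n
      have "inverse (real (Suc (Suc n))) \<le> inverse (real (Suc n))"
        by (rule le_imp_inverse_le) auto
      then show "?A (Suc n) \<le> ?A n" by (auto intro: order_trans)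
    qed
  qed
  also have "(\<Inter>n. ?A n) = {\<omega> \<in> space M. X \<omega> \<le> 0}"
  proof (intro equalityI subsetI)
    fix \<omega> assume \<omega>: "\<omega> \<in> (\<Inter>n. ?A n)"
    then have "X \<omega> \<le> inverse (real (Suc n))" for n by auto
    then have "X \<omega> \<le> 0"
      by (intro LIMSEQ_le_const[OF LIMSEQ_inverse_real_of_nat]) auto
    with \<omega> show "\<omega> \<in> {\<omega> \<in> space M. X \<omega> \<le> 0}" by auto
  next
    fix \<omega> assume "\<omega> \<in> {\<omega> \<in> space M. X \<omega> \<le> 0}"
    moreover have "0 \<le> inverse (real (Suc n))" for n by simp
    ultimately show "\<omega> \<in> (\<Inter>n. ?A n)" using order_trans by blast
  qed
  finally have "(\<lambda>n. prob (?A n)) \<longlonglongrightarrow> 0" using assms(2) by simp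
  then obtain n where "prob (?A n) < r"
    using order_tendstoD(2)[of _ 0 sequentially r] \<open>0 < r\<close> eventually_happens' trivial_limit_sequentially
    by (metis (mono_tags, lifting) sequentially_bot)
  then show ?thesis by (intro exI[of _ "inverse (real (Suc n))"]) auto
qed

text \<open>Continuity from below; it provides a member of the set whose infimum is
  \<open>s_val\<close>.\<close>

lemma (in prob_space) cdf_tendsto_one:
  fixes X :: "'a \<Rightarrow> real"
  assumes X [measurable]: "X \<in> borel_measurable M" and "r < 1"
  shows "\<exists>x>0. r \<le> prob {\<omega> \<in> space M. X \<omega> \<le> x}"
proof -
  let ?A = "\<lambda>n. {\<omega> \<in> space M. X \<omega> \<le> real (Suc n)}"
  have "(\<lambda>n. prob (?A n)) \<longlonglongrightarrow> prob (\<Union>n. ?A n)"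
  proof (rule finite_Lim_measure_incseq)
    show "range ?A \<subseteq> events" by auto
    show "incseq ?A" by (rule incseq_SucI) auto
  qed
  also have "(\<Union>n. ?A n) = space M"
  proof (intro equalityI subsetI)
    fix \<omega> assume "\<omega> \<in> space M"
    moreover obtain n where "X \<omega> \<le> real n" using real_arch_simple by blast
    ultimately have "\<omega> \<in> ?A n" by auto
    then show "\<omega> \<in> (\<Union>n. ?A n)" by blast
  qed auto
  finally have "(\<lambda>n. prob (?A n)) \<longlonglongrightarrow> 1" by (simp add: prob_space)
  then obtain n where "r < prob (?A n)"
    using order_tendstoD(1)[of _ 1 sequentially r] \<open>r < 1\<close> eventually_happens'
    by (metis (mono_tags, lifting) sequentially_bot)
  then show ?thesis by (intro exI[of _ "real (Suc n)"]) auto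
qed

text \<open>Passes from the bounds at all points below \<open>s_val\<close> to the strict event used
  in the lower tail, whose probability is the left limit of the distribution function.\<close>

lemma (in prob_space) cdf_left_limit_le:
  fixes X :: "'a \<Rightarrow> real"
  assumes X [measurable]: "X \<in> borel_measurable M" and nonneg: "\<And>\<omega>. 0 \<le> X \<omega>" and r: "0 \<le> r"
    and le: "\<And>x. 0 < x \<Longrightarrow> x < s \<Longrightarrow> prob {\<omega> \<in> space M. X \<omega> \<le> x} \<le> r"
  shows "prob {\<omega> \<in> space M. X \<omega> < s} \<le> r"
proof (cases "0 < s")
  case False
  have "{\<omega> \<in> space M. X \<omega> < s} = {}"
    using False nonneg by (auto simp: not_less intro: order_trans)
  with r show ?thesis by (simp only: measure_empty)
next
  case True
  \<comment> \<open>The double successor makes the sequence start at \<open>s / 2\<close>, so every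
    term is positive and \<open>le\<close> applies.\<close>
  let ?x = "\<lambda>n. s - s * inverse (real (Suc (Suc n)))"
  let ?A = "\<lambda>n. {\<omega> \<in> space M. X \<omega> \<le> ?x n}"
  have x: "0 < ?x n" "?x n < s" for n
  proof -
    have "inverse (real (Suc (Suc n))) < 1" by (simp add: inverse_less_1_iff)
    then show "0 < ?x n" using mult_strict_left_mono[OF _ True] by fastforce
    show "?x n < s" using True by simp
  qed
  have lim: "?x \<longlonglongrightarrow> s - s * 0"
    by (intro tendsto_diff tendsto_mult tendsto_const LIMSEQ_Suc[OF LIMSEQ_inverse_real_of_nat])
  have "(\<lambda>n. prob (?A n)) \<longlonglongrightarrow> prob (\<Union>n. ?A n)"
  proof (rule finite_Lim_measure_incseq)
    show "range ?A \<subseteq> events" by auto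
    have "?x n \<le> ?x (Suc n)" for n
      using True by (intro diff_left_mono mult_left_mono le_imp_inverse_le) auto
    then show "incseq ?A" by (intro incseq_SucI) (auto intro: order_trans)
  qed
  also have "(\<Union>n. ?A n) = {\<omega> \<in> space M. X \<omega> < s}"
  proof (intro equalityI subsetI)
    fix \<omega> assume "\<omega> \<in> (\<Union>n. ?A n)"
    then obtain n where "\<omega> \<in> space M" "X \<omega> \<le> ?x n" by auto
    with x(2)[of n] show "\<omega> \<in> {\<omega> \<in> space M. X \<omega> < s}" by auto
  next
    fix \<omega> assume \<omega>: "\<omega> \<in> {\<omega> \<in> space M. X \<omega> < s}"
    then have "eventually (\<lambda>n. X \<omega> < ?x n) sequentially"
      using lim by (intro order_tendstoD(1)) auto
    then obtain n where "X \<omega> < ?x n" by (auto simp: eventually_sequentially)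
    then have "\<omega> \<in> ?A n" using \<omega> by auto
    then show "\<omega> \<in> (\<Union>n. ?A n)" by blast
  qed
  finally show ?thesis
    by (rule LIMSEQ_le_const2) (use le x in blast)
qed

text \<open>Converts the tail \<open>exp (- \<tau>)\<close> into the one required in (b). When the
  logarithm is at most 1, powers decrease in the exponent and \<open>1 \<le> \<tau>\<close> is used
  instead.\<close>

lemma ln_square_le:
  assumes "1 \<le> (n::nat)" "1 \<le> \<tau>" "ln (real n) ^ 6 \<le> \<tau>"
  shows "(ln (real n))\<^sup>2 \<le> \<tau>"
proof (cases "ln (real n) \<le> 1")
  case True
  then have "(ln (real n))\<^sup>2 \<le> 1"
    using assms(1) by (intro power_le_one) auto
  with assms show ?thesis by simp
next
  case False
  then have "(ln (real n))\<^sup>2 \<le> ln (real n) ^ 6"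
    by (intro power_increasing) auto
  with assms show ?thesis by simp
qed

text \<open>Non-degeneracy of the thresholds: \<open>t_val\<close> is not a supremum of the empty set, \<open>s_val\<close> is not
  an infimum of the empty set.\<close>
lemma (in prob_space) thresholds_nondegenerate:
  fixes X :: "'a \<Rightarrow> real"
  assumes X: "X \<in> borel_measurable M" and null: "prob {\<omega> \<in> space M. X \<omega> \<le> 0} = 0"
    and low: "\<And>x. 0 \<le> x \<Longrightarrow> F_low x \<le> prob {\<omega> \<in> space M. X \<omega> \<le> x}"
    and up: "\<And>x. 0 \<le> x \<Longrightarrow> prob {\<omega> \<in> space M. X \<omega> \<le> x} \<le> F_up x"
    and \<tau>: "1 \<le> \<tau>" "\<tau> \<le> real n"
  shows "0 < t_val F_low n \<tau>" and "\<exists>s\<ge>0. s_val F_up n \<tau> = ereal s"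
    and "s_val F_up n \<tau> \<le> t_val F_low n \<tau>"
    and "t_val F_low n \<tau> \<noteq> \<infinity> \<Longrightarrow> 8 * \<tau> < real n"
proof -
  have n: "0 < real n" using \<tau> by linarith
  let ?p = "(8 * \<tau> / real n)\<^sup>2" and ?q = "(\<tau> / (64 * real n))\<^sup>2"
  have qp: "?q \<le> ?p" using \<tau> n by (intro power_mono) (auto simp: field_simps)
  have "0 < ?p" using \<tau> n by simp
  then obtain x where x: "0 < x" "prob {\<omega> \<in> space M. X \<omega> \<le> x} \<le> ?p"
    using cdf_tendsto_zero[OF X null] by blast
  then have "F_low x \<le> ?p" using low[of x] by linarith
  then have "ereal x \<le> t_val F_low n \<tau>"
    unfolding t_val_def using x by (intro Sup_upper) auto
  with x show t_pos: "0 < t_val F_low n \<tau>"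
    by (metis ereal_less(2) less_le_trans)
  have "\<tau> / (64 * real n) < 1" using \<tau> n by (simp add: field_simps)
  then have "?q < 1" using \<tau> n by (intro power_less_one_iff[THEN iffD2]) auto
  then obtain y where y: "0 < y" "?q \<le> prob {\<omega> \<in> space M. X \<omega> \<le> y}"
    using cdf_tendsto_one[OF X] by blast
  then have "?q \<le> F_up y" using up[of y] by linarith
  then have "s_val F_up n \<tau> \<le> ereal y"
    unfolding s_val_def using y by (intro Inf_lower) auto
  moreover have s0: "0 \<le> s_val F_up n \<tau>"
    unfolding s_val_def by (intro Inf_greatest) auto
  ultimately show s: "\<exists>s\<ge>0. s_val F_up n \<tau> = ereal s"
    by (cases "s_val F_up n \<tau>") auto
  \<comment> \<open>Every point beyond a finite \<open>t_val\<close> has \<open>F_low\<close>, hence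
    \<open>F_up\<close>, above the larger threshold \<open>?p\<close>, and so lies in the set
    defining \<open>s_val\<close>. The margin \<open>e\<close> is needed because nothing is known at
    \<open>t_val\<close> itself.\<close>
  show "s_val F_up n \<tau> \<le> t_val F_low n \<tau>"
  proof (rule ereal_le_epsilon2)
    fix e :: real assume e: "0 < e"
    show "s_val F_up n \<tau> \<le> t_val F_low n \<tau> + ereal e"
    proof (cases "t_val F_low n \<tau>")
      case (real t)
      then have t: "0 < t" using t_pos by simp
      have "\<not> F_low (t + e) \<le> ?p"
      proof
        assume "F_low (t + e) \<le> ?p"
        then have "ereal (t + e) \<le> t_val F_low n \<tau>"
          unfolding t_val_def using t e by (intro Sup_upper) auto
        then show False using real e by simp
      qed
      then have "?q \<le> F_up (t + e)"
        using low[of "t + e"] up[of "t + e"] t e qp by simp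
      then have "s_val F_up n \<tau> \<le> ereal (t + e)"
        unfolding s_val_def using t e by (intro Inf_lower) auto
      then show ?thesis using real by simp
    qed (use t_pos in auto)
  qed
  \<comment> \<open>Otherwise \<open>?p \<ge> 1\<close>, so all positive points satisfy the
    condition in \<open>t_val\<close> and the supremum is infinite.\<close>
  show "8 * \<tau> < real n" if fin: "t_val F_low n \<tau> \<noteq> \<infinity>"
  proof (rule ccontr)
    assume "\<not> 8 * \<tau> < real n"
    then have "1 \<le> 8 * \<tau> / real n" using n by (simp add: field_simps)
    then have "1 \<le> ?p" by simp
    then have "F_low x \<le> ?p" if "0 < x" for x
      using low[of x] that prob_le_1[of "{\<omega> \<in> space M. X \<omega> \<le> x}"] by linarith
    then have le: "ereal x \<le> t_val F_low n \<tau>" if "0 < x" for x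
      unfolding t_val_def using that by (intro Sup_upper) auto
    obtain t where t: "t_val F_low n \<tau> = ereal t" "0 < t"
      using t_pos fin by (cases "t_val F_low n \<tau>") auto
    show False using le[of "t + 1"] t by simp
  qed
qed

lemma t_val_less:
  assumes "t_val F_low n \<tau> = ereal t" "0 < t" "t < x"
  shows "(8 * \<tau> / real n)\<^sup>2 < F_low x"
proof (rule ccontr)
  assume "\<not> ?thesis"
  then have "ereal x \<le> t_val F_low n \<tau>"
    unfolding t_val_def using assms by (intro Sup_upper) auto
  with assms show False by simp
qed

lemma less_s_val:
  assumes "s_val F_up n \<tau> = ereal s" "0 < x" "x < s"
  shows "F_up x < (\<tau> / (64 * real n))\<^sup>2"
proof (rule ccontr)
  assume "\<not> ?thesis"
  then have "s_val F_up n \<tau> \<le> ereal x"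
    unfolding s_val_def using assms by (intro Inf_lower) auto
  with assms show False by simp
qed

lemma le_c_val:
  assumes "s_val F_up n \<tau> = ereal s" "0 \<le> s" "s_val F_up n \<tau> \<le> t_val F_low n \<tau>"
    and "0 \<le> \<tau>" "\<tau> \<le> real n" "1 \<le> D"
  shows "ereal \<tau> \<le> c_val F_low F_up D n \<tau>"
proof (cases "t_val F_low n \<tau> = \<infinity> \<or> s_val F_up n \<tau> = 0")
  case True
  then show ?thesis using assms by (auto simp: c_val_def Let_def)
next
  case False
  then obtain t where t: "t_val F_low n \<tau> = ereal t" "s \<le> t"
    using assms(1,3) by (cases "t_val F_low n \<tau>") auto
  have s: "0 < s" using False assms by auto
  have "\<tau> * s \<le> (D * \<tau>) * t"
    using assms t s by (intro mult_mono) (auto simp: mult_le_cancel_right1)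
  then have "\<tau> \<le> D * \<tau> * t / s" using s by (simp add: le_divide_eq)
  then show ?thesis
    using False assms t s by (simp add: c_val_def Let_def)
qed

subsection \<open>The theorem\<close>

theorem theorem2:
  fixes M :: "'a measure"
    and w :: "nat \<times> nat \<Rightarrow> 'a \<Rightarrow> real"
    and F_low F_up :: "real \<Rightarrow> real"
  assumes "prob_space M"
    and "prob_space.indep_vars M (\<lambda>_. borel) w K_tot"
    and "\<And>f. f \<in> K_tot \<Longrightarrow> AE \<omega> in M. w f \<omega> \<ge> 0"
    and "mono_on {0..} F_low" and "mono_on {0..} F_up"
    and "\<And>x. x \<ge> 0 \<Longrightarrow> 0 \<le> F_low x \<and> F_low x \<le> F_up x \<and> F_up x \<le> 1"
    and "\<And>x. x \<ge> 0 \<Longrightarrow> F_low x \<le> (INF f\<in>K_tot. measure M {\<omega> \<in> space M. w f \<omega> \<le> x})"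
    and "\<And>x. x \<ge> 0 \<Longrightarrow> (SUP f\<in>K_tot. measure M {\<omega> \<in> space M. w f \<omega> \<le> x}) \<le> F_up x"
    and "F_up 0 = 0"
    and "\<And>x. 0 < x \<Longrightarrow> x \<le> 1 \<Longrightarrow> 0 < F_low x \<and> F_low x \<le> 1"
    and "(SUP f\<in>K_tot. \<integral>\<^sup>+\<omega>. ennreal ((w f \<omega>)\<^sup>2) \<partial>M) < \<infinity>"
  shows "\<exists>\<alpha>1 \<alpha>2 \<beta>1 \<beta>2 \<gamma> :: real.
    \<alpha>1 > 0 \<and> \<alpha>2 > 0 \<and> \<beta>1 > 0 \<and> \<beta>2 > 0 \<and> \<gamma> > 0 \<and>
    (\<forall>(n::nat) (\<tau>::real). n \<ge> 1 \<and> 1 \<le> \<tau> \<and> (ln (real n)) ^ 6 \<le> \<tau> \<and> \<tau> \<le> real n \<longrightarrow>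
      (let M\<^sub>n = (\<lambda>\<omega>. min_weight n \<tau> (\<lambda>f. w f \<omega>));
           s = s_val F_up n \<tau>;
           t = t_val F_low n \<tau>;
           D = max 1 (2 * \<alpha>1 / \<beta>1)
       in (measure M {\<omega> \<in> space M. ereal (M\<^sub>n \<omega>) \<le> ereal (\<alpha>1 * \<tau>) * t} \<ge> 1 - exp (- \<alpha>2 * \<tau>) \<and>
           ereal (prob_space.expectation M M\<^sub>n)
             \<le> ereal (\<alpha>1 * \<tau>) * t + ereal (\<alpha>1 * (real n)\<^sup>2 * exp (- \<alpha>2 * \<tau>))) \<and>
          (measure M {\<omega> \<in> space M. ereal (M\<^sub>n \<omega>) \<ge> ereal (\<beta>1 * \<tau>) * s}
             \<ge> 1 - exp (- \<beta>2 * (ln (real n))\<^sup>2) \<and>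
           ereal (prob_space.expectation M M\<^sub>n) \<ge> ereal (\<beta>1 * \<tau>) * s) \<and>
          ereal (prob_space.variance M M\<^sub>n) \<le> ereal \<gamma> * c_val F_low F_up D n \<tau>))"
proof -
  interpret prob_space M by fact
  \<comment> \<open>Nonnegativity of \<open>w\<close> holds only almost everywhere, whereas the
    combinatorial lemmas need it at every point.\<close>
  define X where "X f \<omega> = \<bar>w f \<omega>\<bar>" for f \<omega>
  \<comment> \<open>The supremum is finite by hypothesis, so \<open>enn2real\<close> does not fall
    back to its value 0 at infinity.\<close>
  define C where "C = enn2real (SUP f\<in>K_tot. \<integral>\<^sup>+\<omega>. ennreal ((w f \<omega>)\<^sup>2) \<partial>M)"
  have w_meas [measurable]: "w f \<in> borel_measurable M" if "f \<in> K_tot" for f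
    using assms(2) that by (auto simp: indep_vars_def)
  have X_meas [measurable]: "X f \<in> borel_measurable M" if "f \<in> K_tot" for f
    using w_meas[OF that] unfolding X_def[abs_def] by measurable
  have X_nonneg: "0 \<le> X f \<omega>" for f \<omega>
    by (simp add: X_def)
  have X_indep: "indep_vars (\<lambda>_. borel) X K_tot"
    using indep_vars_compose2[OF assms(2), of "\<lambda>_ x. \<bar>x\<bar>" "\<lambda>_. borel"]
    unfolding X_def[abs_def] by simp
  have X_eq: "AE \<omega> in M. w f \<omega> = X f \<omega>" if "f \<in> K_tot" for f
    using assms(3)[OF that] by eventually_elim (simp add: X_def)
  have cdf: "prob {\<omega> \<in> space M. X f \<omega> \<le> x} = prob {\<omega> \<in> space M. w f \<omega> \<le> x}" if "f \<in> K_tot" for f x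
    using X_eq[OF that] that by (intro measure_eq_AE) (auto elim!: eventually_mono)
  have low: "F_low x \<le> prob {\<omega> \<in> space M. X f \<omega> \<le> x}" if "0 \<le> x" "f \<in> K_tot" for x f
  proof -
    have "(INF f\<in>K_tot. prob {\<omega> \<in> space M. w f \<omega> \<le> x}) \<le> prob {\<omega> \<in> space M. w f \<omega> \<le> x}"
      using that by (intro cINF_lower bdd_belowI2[where m=0]) auto
    with assms(7)[OF that(1)] show ?thesis using cdf[OF that(2)] by simp
  qed
  have up: "prob {\<omega> \<in> space M. X f \<omega> \<le> x} \<le> F_up x" if "0 \<le> x" "f \<in> K_tot" for x f
  proof -
    have "prob {\<omega> \<in> space M. w f \<omega> \<le> x} \<le> (SUP f\<in>K_tot. prob {\<omega> \<in> space M. w f \<omega> \<le> x})"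
      using that by (intro cSUP_upper bdd_aboveI2[where M=1]) auto
    with assms(8)[OF that(1)] show ?thesis using cdf[OF that(2)] by simp
  qed
  have moment_le: "(\<integral>\<^sup>+\<omega>. ennreal ((X f \<omega>)\<^sup>2) \<partial>M) \<le> (SUP f\<in>K_tot. \<integral>\<^sup>+\<omega>. ennreal ((w f \<omega>)\<^sup>2) \<partial>M)"
    if "f \<in> K_tot" for f
    unfolding X_def power2_abs by (rule SUP_upper[OF that])
  have square: "integrable M (\<lambda>\<omega>. (X f \<omega>)\<^sup>2)" if "f \<in> K_tot" for f
    using that le_less_trans[OF moment_le[OF that] assms(11)] by (intro integrableI_nonneg) auto
  have moment: "expectation (\<lambda>\<omega>. (X f \<omega>)\<^sup>2) \<le> C" if "f \<in> K_tot" for f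
  proof -
    have "expectation (\<lambda>\<omega>. (X f \<omega>)\<^sup>2) = enn2real (\<integral>\<^sup>+\<omega>. ennreal ((X f \<omega>)\<^sup>2) \<partial>M)"
      using that by (intro integral_eq_nn_integral) auto
    also have "\<dots> \<le> C"
      unfolding C_def using assms(11) by (intro enn2real_mono moment_le that) auto
    finally show ?thesis .
  qed
  have C_nonneg: "0 \<le> C" by (simp add: C_def)
  \<comment> \<open>One edge is enough to relate the thresholds, since \<open>F_low\<close> and
    \<open>F_up\<close> bracket the distribution function of every edge.\<close>
  have K11: "(1, 1) \<in> K_tot" by (simp add: K_tot_def)
  have null: "prob {\<omega> \<in> space M. X (1, 1) \<omega> \<le> 0} = 0"
    using up[of 0 "(1, 1)"] K11 assms(9) by (intro antisym measure_nonneg) simp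
  \<comment> \<open>\<open>C + 5\<close> dominates both the 4 coming from
    \<open>2 * \<tau> * (2 * t)\<close> and the factor \<open>(C + 1) / 2\<close> of the truncation
    error; \<open>1 / 6\<close> is half of the tail exponent \<open>1 / 3\<close>;
    \<open>1 / 4\<close> is the product of the threshold factor \<open>1 / 2\<close> and a
    probability of at least \<open>1 / 2\<close>.\<close>
  have main: "measure M {\<omega> \<in> space M. ereal (min_weight n \<tau> (\<lambda>f. w f \<omega>)) \<le> ereal ((C + 5) * \<tau>) * t_val F_low n \<tau>}
      \<ge> 1 - exp (- (1 / 6) * \<tau>)" (is ?a1)
    "ereal (expectation (\<lambda>\<omega>. min_weight n \<tau> (\<lambda>f. w f \<omega>)))
      \<le> ereal ((C + 5) * \<tau>) * t_val F_low n \<tau> + ereal ((C + 5) * (real n)\<^sup>2 * exp (- (1 / 6) * \<tau>))" (is ?a2)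
    "measure M {\<omega> \<in> space M. ereal (min_weight n \<tau> (\<lambda>f. w f \<omega>)) \<ge> ereal (1 / 4 * \<tau>) * s_val F_up n \<tau>}
      \<ge> 1 - exp (- 1 * (ln (real n))\<^sup>2)" (is ?b1)
    "ereal (expectation (\<lambda>\<omega>. min_weight n \<tau> (\<lambda>f. w f \<omega>))) \<ge> ereal (1 / 4 * \<tau>) * s_val F_up n \<tau>" (is ?b2)
    "ereal (variance (\<lambda>\<omega>. min_weight n \<tau> (\<lambda>f. w f \<omega>))) \<le>
      ereal (2 * C + 1) * c_val F_low F_up (max 1 (2 * (C + 5) / (1 / 4))) n \<tau>" (is ?c)
    if n: "n \<ge> 1" and \<tau>: "1 \<le> \<tau>" and ln: "ln (real n) ^ 6 \<le> \<tau>" and \<tau>n: "\<tau> \<le> real n" for n \<tau>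
  proof -
    define Y where "Y \<omega> = min_weight n \<tau> (\<lambda>f. X f \<omega>)" for \<omega>
    let ?W = "\<lambda>\<omega>. min_weight n \<tau> (\<lambda>f. w f \<omega>)"
    have K: "f \<in> K_tot" if "f \<in> K_nn n" for f
      using that by (auto simp: K_nn_def K_tot_def)
    have indep_n: "indep_vars (\<lambda>_. borel) X (K_nn n)"
      using K by (intro indep_vars_subset[OF X_indep]) auto
    have W_meas [measurable]: "?W \<in> borel_measurable M"
      by (rule borel_measurable_min_weight) (simp add: K)
    have Y_meas [measurable]: "Y \<in> borel_measurable M"
      unfolding Y_def[abs_def] by (rule borel_measurable_min_weight) (simp add: K)
    have W_Y: "AE \<omega> in M. ?W \<omega> = Y \<omega>"
    proof -
      have "AE \<omega> in M. \<forall>f\<in>K_nn n. w f \<omega> = X f \<omega>"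
        using X_eq K by (intro AE_finite_allI) auto
      then show ?thesis
        by eventually_elim (auto simp: Y_def intro: min_weight_cong)
    qed
    have expectation_eq: "expectation ?W = expectation Y"
      using W_Y by (intro integral_cong_AE) auto
    have variance_eq: "variance ?W = variance Y"
      unfolding expectation_eq using W_Y by (intro integral_cong_AE) (auto elim!: eventually_mono)
    have Y_bounds: "0 \<le> Y \<omega>" "Y \<omega> \<le> (\<Sum>f\<in>K_nn n. X f \<omega>)" for \<omega>
    proof -
      obtain P where P: "planar_matching n P" "Y \<omega> = matching_weight (\<lambda>f. X f \<omega>) P"
        using min_weight_attained[of n "\<lambda>f. X f \<omega>" \<tau>] X_nonneg \<tau> \<tau>n unfolding Y_def by auto
      show "0 \<le> Y \<omega>"
        unfolding P(2) matching_weight_def by (intro sum_nonneg X_nonneg)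
      show "Y \<omega> \<le> (\<Sum>f\<in>K_nn n. X f \<omega>)"
        unfolding P(2) matching_weight_def using planar_matching_K_nn[OF P(1)]
        by (intro sum_mono2 X_nonneg) auto
    qed
    have int_Y: "integrable M Y"
    proof (rule Bochner_Integration.integrable_bound)
      show "integrable M (\<lambda>\<omega>. \<Sum>f\<in>K_nn n. X f \<omega>)"
        using K by (intro Bochner_Integration.integrable_sum
          square_integrable_imp_integrable[OF X_meas square]) auto
      show "AE \<omega> in M. norm (Y \<omega>) \<le> norm (\<Sum>f\<in>K_nn n. X f \<omega>)"
      proof (rule AE_I2)
        fix \<omega>
        have "\<bar>Y \<omega>\<bar> \<le> (\<Sum>f\<in>K_nn n. X f \<omega>)" using Y_bounds[of \<omega>] by simp
        then show "norm (Y \<omega>) \<le> norm (\<Sum>f\<in>K_nn n. X f \<omega>)" by simp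
      qed
    qed (rule Y_meas)
    have facts: "0 < t_val F_low n \<tau>" "\<exists>s\<ge>0. s_val F_up n \<tau> = ereal s"
      "s_val F_up n \<tau> \<le> t_val F_low n \<tau>" "t_val F_low n \<tau> \<noteq> \<infinity> \<Longrightarrow> 8 * \<tau> < real n"
      using thresholds_nondegenerate[OF X_meas[OF K11] null low[OF _ K11] up[OF _ K11] \<tau> \<tau>n] by simp_all
    obtain s where s: "0 \<le> s" "s_val F_up n \<tau> = ereal s"
      using facts(2) by blast
    have lower: "prob {\<omega> \<in> space M. Y \<omega> < \<tau> * s / 2} \<le> exp (- \<tau>)"
      unfolding Y_def
    proof (rule min_weight_lower_tail[OF indep_n X_nonneg \<tau> \<tau>n s(1)])
      fix f assume "f \<in> K_nn n"
      then have f: "f \<in> K_tot" by (rule K)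
      show "prob {\<omega> \<in> space M. X f \<omega> < s} \<le> (\<tau> / (64 * real n))\<^sup>2"
      proof (rule cdf_left_limit_le[OF X_meas[OF f] X_nonneg])
        fix x assume "0 < x" "x < s"
        then show "prob {\<omega> \<in> space M. X f \<omega> \<le> x} \<le> (\<tau> / (64 * real n))\<^sup>2"
          using up[of x f] f less_s_val[OF s(2), of x] by linarith
      qed simp
    qed
    have compl: "prob {\<omega> \<in> space M. a \<le> Y \<omega>} = 1 - prob {\<omega> \<in> space M. Y \<omega> < a}"
      "prob {\<omega> \<in> space M. Y \<omega> \<le> a} = 1 - prob {\<omega> \<in> space M. a < Y \<omega>}" for a
      by (subst prob_compl[symmetric]; force intro!: arg_cong[of _ _ prob])+
    have \<tau>s: "\<tau> * s / 4 \<le> \<tau> * s / 2" using \<tau> s by simp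
    show ?b1
    proof -
      have "prob {\<omega> \<in> space M. ereal (1 / 4 * \<tau>) * s_val F_up n \<tau> \<le> ereal (?W \<omega>)}
          = prob {\<omega> \<in> space M. \<tau> * s / 4 \<le> Y \<omega>}"
        using W_Y s by (intro measure_eq_AE) (auto elim!: eventually_mono)
      also have "\<dots> \<ge> prob {\<omega> \<in> space M. \<tau> * s / 2 \<le> Y \<omega>}"
        using \<tau>s by (intro finite_measure_mono) auto
      moreover have "1 - exp (- 1 * (ln (real n))\<^sup>2) \<le> prob {\<omega> \<in> space M. \<tau> * s / 2 \<le> Y \<omega>}"
        using lower ln_square_le[OF n \<tau> ln] unfolding compl
        by (smt (verit) exp_le_cancel_iff)
      ultimately show ?thesis by linarith
    qed
    \<comment> \<open>Markov's inequality at level \<open>\<tau> * s / 2\<close>, which is reached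
      with probability at least \<open>1 / 2\<close> because exp \<tau> \<ge> 1 + \<tau> \<ge>
      2.\<close>
    show ?b2
    proof -
      have "exp (- \<tau>) \<le> 1 / 2"
      proof -
        have "2 \<le> exp \<tau>" using exp_ge_add_one_self[of \<tau>] \<tau> by linarith
        then show ?thesis by (simp add: exp_minus field_simps)
      qed
      then have half: "1 / 2 \<le> prob {\<omega> \<in> space M. \<tau> * s / 2 \<le> Y \<omega>}"
        using lower unfolding compl by linarith
      have "\<tau> * s / 4 \<le> \<tau> * s / 2 * prob {\<omega> \<in> space M. \<tau> * s / 2 \<le> Y \<omega>}"
        using mult_left_mono[OF half, of "\<tau> * s / 2"] \<tau> s by simp
      also have "\<dots> = expectation (\<lambda>\<omega>. \<tau> * s / 2 * indicator {\<omega> \<in> space M. \<tau> * s / 2 \<le> Y \<omega>} \<omega>)"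
        by simp
      also have "\<dots> \<le> expectation Y"
        using Y_bounds(1) by (intro integral_mono' int_Y) (auto simp: indicator_def)
      finally show ?thesis by (simp add: expectation_eq s)
    qed
    show ?a1 ?a2
    proof -
      have "?a1 \<and> ?a2"
      proof (cases "t_val F_low n \<tau> = \<infinity>")
        case True
        have "ereal ((C + 5) * \<tau>) * \<infinity> = \<infinity>"
          using \<tau> C_nonneg by simp
        then show ?thesis using True by (simp add: prob_space)
      next
        case False
        then obtain t where t: "t_val F_low n \<tau> = ereal t" "0 < t"
          using facts(1) by (cases "t_val F_low n \<tau>") auto
        \<comment> \<open>Any level beyond \<open>t\<close> would serve: at the supremum itself
          \<open>F_low\<close> may still be below the threshold.\<close>
        have upper: "prob {\<omega> \<in> space M. 2 * \<tau> * (2 * t) < Y \<omega>} \<le> exp (- \<tau> / 3)"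
          unfolding Y_def
        proof (rule min_weight_upper_tail[OF indep_n X_nonneg \<tau> facts(4)[OF False]])
          show "0 \<le> 2 * t" using t by simp
          fix f assume "f \<in> K_nn n"
          then have "F_low (2 * t) \<le> prob {\<omega> \<in> space M. X f \<omega> \<le> 2 * t}"
            using t by (intro low K) auto
          moreover have "(8 * \<tau> / real n)\<^sup>2 < F_low (2 * t)"
            using t by (intro t_val_less[OF t]) auto
          ultimately show "(8 * \<tau> / real n)\<^sup>2 \<le> prob {\<omega> \<in> space M. X f \<omega> \<le> 2 * t}" by linarith
        qed
        have \<tau>t: "2 * \<tau> * (2 * t) \<le> (C + 5) * \<tau> * t"
        proof -
          have "4 * (\<tau> * t) \<le> (C + 5) * (\<tau> * t)"
            using \<tau> t C_nonneg by (intro mult_right_mono) auto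
          then show ?thesis by (simp add: algebra_simps)
        qed
        have "prob {\<omega> \<in> space M. ereal (?W \<omega>) \<le> ereal ((C + 5) * \<tau>) * t_val F_low n \<tau>}
            = prob {\<omega> \<in> space M. Y \<omega> \<le> (C + 5) * \<tau> * t}"
          using W_Y t by (intro measure_eq_AE) (auto elim!: eventually_mono)
        also have "\<dots> \<ge> prob {\<omega> \<in> space M. Y \<omega> \<le> 2 * \<tau> * (2 * t)}"
          using \<tau>t by (intro finite_measure_mono) auto
        moreover have "1 - exp (- (1 / 6) * \<tau>) \<le> prob {\<omega> \<in> space M. Y \<omega> \<le> 2 * \<tau> * (2 * t)}"
        proof -
          have "exp (- \<tau> / 3) \<le> exp (- (1 / 6) * \<tau>)" using \<tau> by simp
          then show ?thesis using upper unfolding compl by linarith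
        qed
        ultimately have ?a1 by linarith
        \<comment> \<open>The square root of the tail bound, as the truncation lemma requires; this
          halves the exponent.\<close>
        define \<delta> where "\<delta> = exp (- (1 / 6) * \<tau>)"
        have \<delta>2: "\<delta>\<^sup>2 = exp (- \<tau> / 3)"
          using exp_of_nat_mult[of 2 "- (1 / 6) * \<tau>"] by (simp add: \<delta>_def)
        have "expectation Y \<le> 2 * \<tau> * (2 * t) + real (card (K_nn n)) * ((C + 1) / 2 * \<delta>)"
        proof (rule expectation_le_truncated[OF Y_meas Y_bounds])
          show "prob {\<omega> \<in> space M. 2 * \<tau> * (2 * t) < Y \<omega>} \<le> \<delta>\<^sup>2"
            using upper by (simp add: \<delta>2)
        qed (use \<tau> t K square moment in \<open>auto simp: \<delta>_def\<close>)
        also have "real (card (K_nn n)) = (real n)\<^sup>2"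
          by (simp add: K_nn_def card_cartesian_product power2_eq_square)
        also have "(real n)\<^sup>2 * ((C + 1) / 2 * \<delta>) \<le> (real n)\<^sup>2 * ((C + 5) * \<delta>)"
          using C_nonneg by (intro mult_left_mono mult_right_mono) (auto simp: \<delta>_def)
        also have "(real n)\<^sup>2 * ((C + 5) * \<delta>) = (C + 5) * (real n)\<^sup>2 * exp (- (1 / 6) * \<tau>)"
          by (simp add: \<delta>_def)
        finally have "expectation Y \<le> (C + 5) * \<tau> * t + (C + 5) * (real n)\<^sup>2 * exp (- (1 / 6) * \<tau>)"
          using \<tau>t by linarith
        then have ?a2 unfolding t(1) expectation_eq by simp
        with \<open>?a1\<close> show ?thesis ..
      qed
      then show ?a1 ?a2 by blast+
    qed
    show ?c
    proof -
      define m where "m = nat \<lceil>\<tau>\<rceil>"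
      let ?S = "{P. planar_matching n P \<and> card P = m}"
      have m: "real m \<le> 2 * \<tau>" using \<tau> unfolding m_def by linarith
      have mn: "m \<le> n" using \<tau>n unfolding m_def by linarith
      have "Y \<omega> = Min ((\<lambda>P. \<Sum>f\<in>P. \<bar>X f \<omega>\<bar>) ` ?S)" for \<omega>
      proof -
        have "Y \<omega> = Min (matching_weight (\<lambda>f. X f \<omega>) ` ?S)"
          unfolding Y_def m_def using X_nonneg \<tau> \<tau>n by (intro min_weight_eq_Min) auto
        also have "matching_weight (\<lambda>f. X f \<omega>) = (\<lambda>P. \<Sum>f\<in>P. \<bar>X f \<omega>\<bar>)"
          by (intro ext) (simp add: matching_weight_def X_nonneg)
        finally show ?thesis .
      qed
      then have Y_eq: "Y = (\<lambda>\<omega>. Min ((\<lambda>P. \<Sum>f\<in>P. \<bar>X f \<omega>\<bar>) ` ?S))" by (rule ext)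
      have "variance Y \<le> C * real m"
        unfolding Y_eq
      proof (rule variance_Min_sum_le[OF indep_n])
        show "K_nn n \<noteq> {}" using n by (auto simp: K_nn_def)
        show "finite ?S" by (rule finite_subset[OF _ finite_planar_matchings]) auto
        show "?S \<noteq> {}" using ex_planar_matching[OF mn] by blast
      qed (use K square moment planar_matching_K_nn in auto)
      also have "\<dots> \<le> C * (2 * \<tau>)"
        using m C_nonneg by (rule mult_left_mono)
      \<comment> \<open>The summand 1 keeps the variance constant positive when
        \<open>C = 0\<close>.\<close>
      also have "\<dots> \<le> (2 * C + 1) * \<tau>"
        using \<tau> by (simp add: algebra_simps)
      finally have "ereal (variance Y) \<le> ereal (2 * C + 1) * ereal \<tau>" by simp
      also have "\<dots> \<le> ereal (2 * C + 1) * c_val F_low F_up (max 1 (2 * (C + 5) / (1 / 4))) n \<tau>"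
        using C_nonneg \<tau> \<tau>n
        by (intro ereal_mult_left_mono le_c_val[OF s(2) s(1) facts(3)]) auto
      finally show ?thesis unfolding variance_eq .
    qed
  qed
  show ?thesis
    unfolding Let_def
    by (rule exI[of _ "C + 5"], rule exI[of _ "1 / 6"], rule exI[of _ "1 / 4"], rule exI[of _ 1],
        rule exI[of _ "2 * C + 1"]) (use C_nonneg main in auto)
qed

end
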